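(* For every $\sigma\in(0,1]$ there is a constant $C(\sigma)>0$ depending only on $\sigma$ such that the following holds. Let $n\in\mathbb N$, $Q\ge 1$, $\delta_*\in(0,\frac12)$, $\omega_*\in(0,\frac12)$, and put $$\varepsilon := Q\exp\bigl(-C(\sigma)\log(Qn/\omega_* )\log n\bigr),\qquad N := \bigl\lceil C(\sigma)\log^2(Qn/\omega_* )\,(\log(1/\delta_* )+n)\bigr\rceil .$$ There is a probabilistic adaptive algorithm such that, for any function $f\in\mathcal R(H(\sigma,Q),B_2^n)$, it uses $N$ evaluations of $f$ with errors not exceeding $\varepsilon$ and outputs an approximation $\widetilde f$ such that, with probability at least $1-\delta_*$, $$\max_{x\in B_2^n}|\widetilde f(x)-f(x)|\le\omega_*.$$
   Context: $B_2^n=\{x\in\mathbb R^n: |x|\le 1\}$ is the closed Euclidean unit ball, $|\cdot|$ the Euclidean norm and $\langle\cdot,\cdot\rangle$ the standard scalar product. For $\sigma>0$, $Q>0$, $H(\sigma,Q)$ is the class of functions $\varphi$ analytic in the rectangle $\Pi_\sigma=\{z=t+iy: |t|\le 1+\sigma,\ |y|\le\sigma\}$ (with $t,y$ real) such that $|\varphi(z)|\le Q$ for $z\in\Pi_\sigma$ and $\varphi(z)$ is real for real $z$. For a class $\Phi$ of functions $\varphi\colon[-1,1]\to\mathbb R$ (functions in $H(\sigma,Q)$ are restricted to $[-1,1]$), $\mathcal R(\Phi,B_2^n)$ denotes the class of ridge functions $f\colon B_2^n\to\mathbb R$ of the form $f(x)=\varphi(\langle a,x\rangle)$ with $a\in\mathbb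 R^n$, $|a|=1$, $\varphi\in\Phi$. Evaluation model: the algorithm is given the parameters $n,\sigma,Q,\delta_*,\omega_*$ but does not know $f$ (neither $a$ nor $\varphi$). It chooses points $x^1,\dots,x^N\in B_2^n$; after prescribing $x^i$ it receives a real number $y_i$ with $|y_i-f(x^i)|\le\varepsilon$ (an evaluation of $f$ with error not exceeding $\varepsilon$). It is adaptive if $x^{i+1}$ may depend on $y_1,\dots,y_i$. It is probabilistic if it may use internal randomness; the probability in the claim is with respect to this randomness.
   Formalization: The formal theorem assumes n ≥ 2: for n = 1 one has log n = 0, so ε = Q ≥ 1, and the constant functions 1 and −1 both admit the answers 0,…,0, so no algorithm can distinguish them and the claim fails. *)

theory Defs
  imports "HOL-Probability.Probability" "HOL-Complex_Analysis.Complex_Analysis"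
begin

(* The dimension n is quantified inside the theorem (the constant must not depend on it), so
   vectors of R^n are the points of the library's Euclidean_space n: sequences x with x i = 0
   for i >= n. *)

definition scalar_prod_n :: "nat \<Rightarrow> (nat \<Rightarrow> real) \<Rightarrow> (nat \<Rightarrow> real) \<Rightarrow> real" where
  "scalar_prod_n n x y = (\<Sum>i<n. x i * y i)"

definition norm_n :: "nat \<Rightarrow> (nat \<Rightarrow> real) \<Rightarrow> real" where
  "norm_n n x = L2_set x {..<n}"

definition unit_ball_n :: "nat \<Rightarrow> (nat \<Rightarrow> real) set" where
  "unit_ball_n n = {x \<in> topspace (Euclidean_space n). norm_n n x \<le> 1}"

definition rectangle :: "real \<Rightarrow> complex set" where
  "rectangle \<sigma> = {z. \<bar>Re z\<bar> \<le> 1 + \<sigma> \<and> \<bar>Im z\<bar> \<le> \<sigma>}"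

(* The rectangle is closed; analytic_on means analytic in a neighbourhood of each of its points. *)

definition analytic_class :: "real \<Rightarrow> real \<Rightarrow> (complex \<Rightarrow> complex) set" where
  "analytic_class \<sigma> Q =
     {\<phi>. \<phi> analytic_on rectangle \<sigma> \<and>
          (\<forall>z \<in> rectangle \<sigma>. cmod (\<phi> z) \<le> Q) \<and>
          (\<forall>z \<in> rectangle \<sigma>. z \<in> \<real> \<longrightarrow> \<phi> z \<in> \<real>)}"

definition real_trace :: "(complex \<Rightarrow> complex) \<Rightarrow> real \<Rightarrow> real" where
  "real_trace \<phi> t = Re (\<phi> (complex_of_real t))"

(* Functions on the ball are total functions whose values off the ball are irrelevant. Likewise
   only the values of the profile on [-1,1] matter, since \<bar>\<langle>a,x\<rangle>\<bar> \<le> 1. *)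

definition ridge_class :: "(real \<Rightarrow> real) set \<Rightarrow> nat \<Rightarrow> ((nat \<Rightarrow> real) \<Rightarrow> real) set" where
  "ridge_class \<Phi> n =
     {f. \<exists>a \<phi>. a \<in> topspace (Euclidean_space n) \<and> norm_n n a = 1 \<and> \<phi> \<in> \<Phi> \<and>
          (\<forall>x \<in> unit_ball_n n. f x = \<phi> (scalar_prod_n n a x))}"

(* For a realisation w of the internal randomness, query w [y_1, ..., y_i] is the point x^(i+1),
   and approx w [y_1, ..., y_N] is the function that is output after N evaluations. *)

definition prob_adaptive_algorithm ::
  "nat \<Rightarrow> 'w measure \<Rightarrow> ('w \<Rightarrow> real list \<Rightarrow> nat \<Rightarrow> real) \<Rightarrow>
   ('w \<Rightarrow> real list \<Rightarrow> (nat \<Rightarrow> real) \<Rightarrow> real) \<Rightarrow> bool" where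
  "prob_adaptive_algorithm n M query approx \<longleftrightarrow>
     prob_space M \<and>
     (\<forall>w \<in> space M. \<forall>ys. query w ys \<in> unit_ball_n n) \<and>
     (\<forall>ys i. (\<lambda>w. query w ys i) \<in> borel_measurable M) \<and>
     (\<forall>ys. \<forall>x \<in> unit_ball_n n. (\<lambda>w. approx w ys x) \<in> borel_measurable M)"

(* ys is a possible list of answers, with errors at most \<epsilon>, to the queries asked about f.
   The errors are otherwise arbitrary. *)

definition admissible_answers ::
  "real \<Rightarrow> ((nat \<Rightarrow> real) \<Rightarrow> real) \<Rightarrow> (real list \<Rightarrow> nat \<Rightarrow> real) \<Rightarrow> real list \<Rightarrow> bool" where
  "admissible_answers \<epsilon> f q ys \<longleftrightarrow>
     (\<forall>i < length ys. \<bar>ys ! i - f (q (take i ys))\<bar> \<le> \<epsilon>)"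

(* At n = 1 the error bound is Q: then the constants 1 and -1 both admit the answers 0, ..., 0
   and no algorithm can tell them apart. Hence results with this bound need n >= 2. *)

definition error_bound :: "real \<Rightarrow> nat \<Rightarrow> real \<Rightarrow> real \<Rightarrow> real" where
  "error_bound C n Q \<omega> = Q * exp (- C * ln (Q * real n / \<omega>) * ln (real n))"

definition num_evals :: "real \<Rightarrow> nat \<Rightarrow> real \<Rightarrow> real \<Rightarrow> real \<Rightarrow> nat" where
  "num_evals C n Q \<delta> \<omega> =
     nat \<lceil>C * (ln (Q * real n / \<omega>))\<^sup>2 * (ln (1 / \<delta>) + real n)\<rceil>"

end

theory Submission
  imports Defs
begin

text \<open>
  Sample a profile along every coordinate axis at equispaced nodes, and take a difference quotient in
  the axis direction at each node. If all quotients are tiny, then along an axis with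
  \<open>\<bar>a i\<bar> \<ge> 1/n\<close> the derivative of the profile is tiny at a number of
  equispaced points proportional to \<open>ln (Q n / \<omega>)\<close>; by Lagrange interpolation, division by the zeros and a chain of discs it is
  tiny on \<open>[-1, 1]\<close>, and the function is almost constant. Otherwise the gradient at a node with
  a large quotient determines \<open>a\<close> up to sign, and the same extrapolation applied to
  the difference of two profiles shows that they agree up to \<open>\<omega>\<close>. Hence any two ridge functions
  that admit the same answers are close, and the algorithm may output any function of the class that
  admits the answers it received. No randomness is needed.
\<close>

text \<open>The direction is unknown, so a sample at \<open>node j\<close> on axis \<open>i\<close>
  meets the profile at the unknown argument \<open>a i * node j\<close>. These arguments never have
  to be known: two candidates are compared, and extrapolation only uses that the arguments are
  equispaced from 0. The price is their spread. Only \<open>\<bar>a i\<bar> \<ge> 1 / n\<close> is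
  guaranteed for some axis, so the arguments may fill an interval of length of order 1 / n, and
  extrapolating from \<open>K\<close> of them multiplies errors by roughly (const * n) ^ K. The
  chain of discs divides the exponent by a factor depending on \<sigma> alone, so \<open>K\<close>
  proportional to L = ln (Q n / \<omega>) suffices; the amplification is then exp (const * L * ln
  n), whence the product of logarithms in the error bound. A separation of scales makes the
  direction recoverable: with step T ^ 2 and answer errors Q * T ^ 4 a quotient is accurate to order
  T ^ 2, one power below the threshold \<open>T\<close>. A quotient above the threshold fixes the
  gradient up to a relative error of order \<open>T\<close>, while quotients below it are small
  enough to be extrapolated.\<close>

section \<open>Smallness on discs: division by zeros, Lagrange interpolation, three circles\<close>

text \<open>The zeros are divided out one by one: on the circle of radius \<open>R\<close> each
  divisor is at least \<open>R - r\<close>, and the maximum modulus principle carries the bound on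
  the quotient inside.\<close>

lemma bound_by_zeros:
  fixes F :: "complex \<Rightarrow> complex"
  assumes "finite S" and "F analytic_on cball 0 R" and "r < R" and "0 \<le> B"
    and "\<And>z. z \<in> cball 0 R \<Longrightarrow> norm (F z) \<le> B"
    and "\<And>t. t \<in> S \<Longrightarrow> norm t \<le> r \<and> F t = 0"
    and "norm z \<le> R"
  shows "norm (F z) \<le> B * (\<Prod>t\<in>S. norm (z - t) / (R - r))"
  using assms(1,2,4-)
proof (induction S arbitrary: F B z rule: finite_induct)
  case empty
  then show ?case by simp
next
  case (insert t S)
  \<comment> \<open>The value \<open>deriv F t\<close> removes the singularity, so \<open>H\<close>
    is analytic on the whole disc and inherits the remaining zeros.\<close>
  define H where "H = (\<lambda>w. if w = t then deriv F t else F w / (w - t))"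
  have t: "norm t \<le> r" "F t = 0"
    using insert.prems by auto
  have factor: "F w = (w - t) * H w" for w
    using t by (auto simp: H_def)
  have H: "H analytic_on cball 0 R"
    by (rule pole_theorem_analytic_open_superset_0[where T = UNIV and a = t, OF insert.prems(1)])
      (use t in \<open>auto simp: H_def\<close>)
  have H_cont: "continuous_on (cball 0 R) H"
    using H analytic_imp_holomorphic holomorphic_on_imp_continuous_on by blast
  have H_frontier: "norm (H w) \<le> B / (R - r)" if "norm w = R" for w
  proof -
    have "R - r \<le> norm (w - t)"
      using norm_triangle_ineq2[of w t] t that by linarith
    moreover have "norm (F w) \<le> B"
      using insert.prems(3) that by simp
    moreover have "norm (H w) = norm (F w) / norm (w - t)"
      using that t assms(3) by (auto simp: H_def norm_divide)
    ultimately show ?thesis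
      using assms(3) insert.prems(2) by (simp add: frac_le)
  qed
  have H_bound: "norm (H w) \<le> B / (R - r)" if "w \<in> cball 0 R" for w
  proof (rule maximum_modulus_frontier[of H "cball 0 R"])
    show "H holomorphic_on interior (cball 0 R)"
      by (metis H analytic_imp_holomorphic analytic_on_subset interior_subset)
  qed (use that H_cont H_frontier frontier_cball[of "0::complex" R] in auto)
  have "norm (H z) \<le> B / (R - r) * (\<Prod>t\<in>S. norm (z - t) / (R - r))"
  proof (rule insert.IH[OF H])
    show "0 \<le> B / (R - r)"
      using assms(3) insert.prems(2) by simp
    show "norm t' \<le> r \<and> H t' = 0" if "t' \<in> S" for t'
      using that insert.prems(4)[of t'] insert.hyps by (auto simp: H_def)
  qed (use H_bound insert.prems in auto)
  then have "norm (z - t) * norm (H z)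
      \<le> norm (z - t) * (B / (R - r) * (\<Prod>t\<in>S. norm (z - t) / (R - r)))"
    by (intro mult_left_mono) auto
  then show ?case
    using insert.hyps by (simp add: factor[of z] norm_mult mult_ac)
qed

text \<open>Up to the mesh width these are the denominators of the Lagrange basis; as factorials
  they combine into binomial coefficients.\<close>

lemma prod_index_differences:
  assumes "j < K"
  shows "(\<Prod>i\<in>{..<K}-{j}. \<bar>real j - real i\<bar>) = fact j * fact (K - 1 - j)"
proof -
  have split: "{..<K} - {j} = {..<j} \<union> {Suc j..<K}"
    using assms by auto
  have "(\<Prod>i<j. \<bar>real j - real i\<bar>) = (\<Prod>i<j. real (Suc i))"
    by (rule prod.reindex_bij_witness[of _ "\<lambda>i. j - 1 - i" "\<lambda>i. j - 1 - i"]) auto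
  also have "\<dots> = fact j"
    by (simp only: fact_prod_Suc of_nat_prod lessThan_atLeast0)
  finally have low: "(\<Prod>i<j. \<bar>real j - real i\<bar>) = fact j" .
  have "(\<Prod>i\<in>{Suc j..<K}. \<bar>real j - real i\<bar>) = (\<Prod>i<K - 1 - j. real (Suc i))"
    by (rule prod.reindex_bij_witness[of _ "\<lambda>i. i + Suc j" "\<lambda>i. i - Suc j"]) (use assms in auto)
  also have "\<dots> = fact (K - 1 - j)"
    by (simp only: fact_prod_Suc of_nat_prod lessThan_atLeast0)
  finally have high: "(\<Prod>i\<in>{Suc j..<K}. \<bar>real j - real i\<bar>) = fact (K - 1 - j)" .
  show ?thesis
    unfolding split low[symmetric] high[symmetric] by (rule prod.union_disjoint) auto
qed

text \<open>A single term of the exponential series; it stands in for Stirling's formula.\<close>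

lemma power_le_fact_exp: "real K ^ k \<le> fact k * exp (real K)"
proof -
  have "(\<Sum>i\<in>{k}. inverse (fact i) * real K ^ i) \<le> (\<Sum>i. inverse (fact i) * real K ^ i)"
    by (rule sum_le_suminf[OF summable_exp]) auto
  then have "real K ^ k / fact k \<le> exp (real K)"
    by (simp add: exp_def divide_inverse mult.commute)
  then show ?thesis
    by (simp add: pos_divide_le_eq mult.commute)
qed

text \<open>The base is 12 = 2 * 2 * 3: each numerator is at most 2, the binomial coefficients sum
  to \<open>2 ^ (K - 1)\<close>, and \<open>K ^ (K - 1) / fact (K - 1) \<le> 3 ^ K\<close>. The
  power of \<open>1 / \<bar>r\<bar>\<close> comes from the mesh \<open>\<bar>r\<bar> / K\<close> in
  the denominators and is the amplification of sample errors.\<close>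

lemma interpolant_bound:
  fixes v :: "nat \<Rightarrow> complex" and r e :: real
  defines "t \<equiv> \<lambda>j K. complex_of_real (r * real j / real K)"
  assumes "r \<noteq> 0" and "\<bar>r\<bar> \<le> 1" and "norm z \<le> 1" and "0 < K"
    and v: "\<And>j. j < K \<Longrightarrow> norm (v j) \<le> e"
  shows "norm (\<Sum>j<K. v j * (\<Prod>i\<in>{..<K}-{j}. (z - t i K) / (t j K - t i K)))
    \<le> e * (12 / \<bar>r\<bar>) ^ K"
proof -
  have e: "0 \<le> e"
    using v[OF assms(5)] norm_ge_zero order_trans by blast
  have t_norm: "norm (t i K) \<le> 1" if "i < K" for i
  proof -
    have "norm (t i K) = \<bar>r\<bar> * (real i / real K)"
      unfolding t_def norm_of_real by (simp add: abs_mult)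
    also have "\<dots> \<le> 1 * 1"
      using assms that by (intro mult_mono) auto
    finally show ?thesis by simp
  qed
  have t_diff: "norm (t j K - t i K) = \<bar>r\<bar> / K * \<bar>real j - real i\<bar>" for i j
  proof -
    have "t j K - t i K = of_real (r / K * (real j - real i))"
      unfolding t_def of_real_diff[symmetric]
      by (intro arg_cong[where f = of_real]) (simp add: right_diff_distrib diff_divide_distrib)
    then show ?thesis
      by (simp only: norm_of_real) (simp add: abs_mult)
  qed
  have basis: "norm (\<Prod>i\<in>{..<K}-{j}. (z - t i K) / (t j K - t i K))
      \<le> (2 * K / \<bar>r\<bar>) ^ (K - 1) * (real ((K - 1) choose j) / fact (K - 1))" if j: "j < K" for j
  proof -
    have "norm (\<Prod>i\<in>{..<K}-{j}. (z - t i K) / (t j K - t i K))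
        = (\<Prod>i\<in>{..<K}-{j}. norm ((z - t i K) / (t j K - t i K)))"
      by (simp add: prod_norm)
    also have "\<dots> \<le> (\<Prod>i\<in>{..<K}-{j}. (2 * K / \<bar>r\<bar>) / \<bar>real j - real i\<bar>)"
    proof (rule prod_mono, intro conjI)
      fix i assume i: "i \<in> {..<K} - {j}"
      have "norm (z - t i K) \<le> 2"
        using norm_triangle_ineq4[of z "t i K"] t_norm[of i] i assms(4) by auto
      then have "norm ((z - t i K) / (t j K - t i K)) \<le> 2 / norm (t j K - t i K)"
        unfolding norm_divide by (intro divide_right_mono) auto
      also have "\<dots> = (2 * K / \<bar>r\<bar>) / \<bar>real j - real i\<bar>"
        unfolding t_diff by simp
      finally show "norm ((z - t i K) / (t j K - t i K)) \<le> (2 * K / \<bar>r\<bar>) / \<bar>real j - real i\<bar>" .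
    qed auto
    also have "\<dots> = (2 * K / \<bar>r\<bar>) ^ (K - 1) / (fact j * fact (K - 1 - j))"
      using j by (simp only: prod_dividef prod_index_differences[OF j] prod_constant)
        (simp add: power_divide power_mult_distrib)
    also have "\<dots> = (2 * K / \<bar>r\<bar>) ^ (K - 1) * (real ((K - 1) choose j) / fact (K - 1))"
      using j by (subst binomial_fact) auto
    finally show ?thesis .
  qed
  have "norm (\<Sum>j<K. v j * (\<Prod>i\<in>{..<K}-{j}. (z - t i K) / (t j K - t i K)))
      \<le> (\<Sum>j<K. e * ((2 * K / \<bar>r\<bar>) ^ (K - 1) * (real ((K - 1) choose j) / fact (K - 1))))"
  proof (rule sum_norm_le)
    fix j assume "j \<in> {..<K}"
    then show "norm (v j * (\<Prod>i\<in>{..<K}-{j}. (z - t i K) / (t j K - t i K)))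
        \<le> e * ((2 * K / \<bar>r\<bar>) ^ (K - 1) * (real ((K - 1) choose j) / fact (K - 1)))"
      unfolding norm_mult using v basis e by (intro mult_mono) auto
  qed
  also have "\<dots> = e * ((2 * K / \<bar>r\<bar>) ^ (K - 1) * ((\<Sum>j<K. real ((K - 1) choose j)) / fact (K - 1)))"
    by (simp add: sum_distrib_left sum_divide_distrib)
  also have "(\<Sum>j<K. real ((K - 1) choose j)) = 2 ^ (K - 1)"
  proof -
    have "{..<K} = {..K - 1}"
      using assms(5) by auto
    then have "(\<Sum>j<K. real ((K - 1) choose j)) = real (\<Sum>j\<le>K - 1. (K - 1) choose j)"
      by simp
    then show ?thesis
      by (simp only: choose_row_sum) simp
  qed
  also have "(2 * K / \<bar>r\<bar>) ^ (K - 1) * (2 ^ (K - 1) / fact (K - 1))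
      = (4 / \<bar>r\<bar>) ^ (K - 1) * (real K ^ (K - 1) / fact (K - 1))"
    using power_mult_distrib[of "2::real" 2 "K - 1"] by (simp add: power_divide power_mult_distrib)
  also have "e * \<dots> \<le> e * ((4 / \<bar>r\<bar>) ^ K * 3 ^ K)"
  proof (intro mult_left_mono mult_mono)
    show "(4 / \<bar>r\<bar>) ^ (K - 1) \<le> (4 / \<bar>r\<bar>) ^ K"
      using assms(2,3) by (intro power_increasing) (auto simp: field_simps)
    have "real K ^ (K - 1) / fact (K - 1) \<le> exp (real K)"
      using power_le_fact_exp[of K "K - 1"] by (simp add: pos_divide_le_eq mult.commute)
    also have "\<dots> = exp 1 ^ K"
      using exp_of_nat_mult[of K "1::real"] by simp
    also have "\<dots> \<le> 3 ^ K"
      by (intro power_mono exp_le) simp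
    finally show "real K ^ (K - 1) / fact (K - 1) \<le> 3 ^ K" .
  qed (use e in auto)
  also have "\<dots> = e * (12 / \<bar>r\<bar>) ^ K"
    by (simp flip: power_mult_distrib)
  finally show ?thesis .
qed

text \<open>\<open>G\<close> is its Lagrange interpolant \<open>P\<close> plus a remainder that
  vanishes at all \<open>K\<close> nodes. Since 36 = 12 * 3, the hypothesis \<open>small\<close>
  makes \<open>P\<close> at most \<open>1 / 3 ^ K\<close>; the zeros make the remainder comparably
  small on the inner disc.\<close>

lemma small_at_samples_imp_small_near:
  fixes G :: "complex \<Rightarrow> complex" and r e B \<rho> :: real
  assumes G: "G analytic_on cball 0 \<rho>"
    and \<rho>: "0 < \<rho>" "\<rho> \<le> 1" and r: "r \<noteq> 0" "\<bar>r\<bar> \<le> \<rho> / 16" and "0 < K"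
    and B: "\<And>z. z \<in> cball 0 \<rho> \<Longrightarrow> norm (G z) \<le> B"
    and e: "\<And>j. j < K \<Longrightarrow> norm (G (of_real (r * real j / real K))) \<le> e"
    and small: "e * (36 / \<bar>r\<bar>) ^ K \<le> 1"
    and z: "norm z \<le> \<rho> / 4"
  shows "norm (G z) \<le> (B + 2) / 3 ^ K"
proof -
  define t where "t = (\<lambda>j. complex_of_real (r * real j / real K))"
  define P where "P = (\<lambda>z. \<Sum>j<K. G (t j) * (\<Prod>i\<in>{..<K}-{j}. (z - t i) / (t j - t i)))"
  have P_le: "norm (P w) \<le> 1 / 3 ^ K" if "norm w \<le> 1" for w
  proof -
    have "norm (P w) \<le> e * (12 / \<bar>r\<bar>) ^ K"
      unfolding P_def t_def using r \<rho> that \<open>0 < K\<close> e by (intro interpolant_bound) auto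
    also have "\<dots> = e * (36 / \<bar>r\<bar>) ^ K / 3 ^ K"
      using power_mult_distrib[of "12::real" 3 K] by (simp add: power_divide)
    also have "\<dots> \<le> 1 / 3 ^ K"
      using small by (intro divide_right_mono) auto
    finally show ?thesis .
  qed
  have t_inj: "t i = t j \<longleftrightarrow> i = j" for i j
    using r \<open>0 < K\<close> by (auto simp: t_def)
  have t_norm: "norm (t j) \<le> \<rho> / 16" if "j < K" for j
  proof -
    have "norm (t j) = \<bar>r\<bar> * (real j / real K)"
      unfolding t_def norm_of_real by (simp add: abs_mult)
    also have "\<dots> \<le> \<bar>r\<bar> * 1"
      using that by (intro mult_left_mono) auto
    finally show ?thesis using r by simp
  qed
  have P_t: "P (t k) = G (t k)" if "k < K" for k
  proof -
    have "P (t k) = (\<Sum>j<K. if j = k then G (t k) else 0)"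
      unfolding P_def
    proof (rule sum.cong[OF refl])
      fix j assume j: "j \<in> {..<K}"
      show "G (t j) * (\<Prod>i\<in>{..<K}-{j}. (t k - t i) / (t j - t i)) = (if j = k then G (t k) else 0)"
      proof (cases "j = k")
        case True
        then have "(\<Prod>i\<in>{..<K}-{j}. (t k - t i) / (t j - t i)) = 1"
          by (intro prod.neutral) (auto simp: t_inj)
        then show ?thesis using True by simp
      next
        case False
        then have "(\<Prod>i\<in>{..<K}-{j}. (t k - t i) / (t j - t i)) = 0"
          using that by (intro prod_zero) auto
        then show ?thesis using False by simp
      qed
    qed
    then show ?thesis using that by simp
  qed
  have F: "(\<lambda>w. G w - P w) analytic_on cball 0 \<rho>"
    unfolding P_def
    by (intro analytic_on_diff G analytic_on_sum analytic_on_mult analytic_on_prod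
        analytic_on_divide analytic_on_const analytic_on_ident) (auto simp: t_inj)
  have pow: "(1::real) / 3 ^ K \<le> 1"
    by simp
  have B0: "0 \<le> B"
    using B[of 0] \<rho> norm_ge_zero order_trans by (metis centre_in_cball less_imp_le)
  have "norm (G z - P z) \<le> (B + 1) * (\<Prod>s\<in>t ` {..<K}. norm (z - s) / (\<rho> - \<rho> / 16))"
  proof (rule bound_by_zeros[OF _ F])
    fix w :: complex assume w: "w \<in> cball 0 \<rho>"
    show "norm (G w - P w) \<le> B + 1"
      using norm_triangle_ineq4[of "G w" "P w"] B[OF w] order_trans[OF P_le[of w] pow] w \<rho> by auto
  qed (use \<rho> z B0 P_t t_norm in auto)
  \<comment> \<open>The radii are chosen for this factor: (1/4 + 1/16) / (1 - 1/16) = 1/3 per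
    zero.\<close>
  also have "(\<Prod>s\<in>t ` {..<K}. norm (z - s) / (\<rho> - \<rho> / 16)) \<le> (\<Prod>s\<in>t ` {..<K}. 1 / 3)"
  proof (intro prod_mono conjI)
    fix s assume "s \<in> t ` {..<K}"
    then have "norm (z - s) \<le> \<rho> / 4 + \<rho> / 16"
      using norm_triangle_ineq4[of z s] t_norm z by fastforce
    then show "norm (z - s) / (\<rho> - \<rho> / 16) \<le> 1 / 3"
      using \<rho> by (simp add: field_simps)
  qed (use \<rho> in auto)
  also have "\<dots> = 1 / 3 ^ K"
    by (simp add: card_image inj_on_def t_inj power_divide)
  finally have "norm (G z - P z) \<le> (B + 1) * (1 / 3 ^ K)"
    using B0 by (simp add: mult_left_mono)
  moreover have "norm (P z) \<le> 1 / 3 ^ K"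
    using P_le z \<rho> by simp
  moreover have "norm (G z) \<le> norm (G z - P z) + norm (P z)"
    by (metis diff_add_cancel norm_triangle_ineq)
  moreover have "(B + 1) * (1 / 3 ^ K) + 1 / 3 ^ K = (B + 2) / 3 ^ K"
    by (simp add: field_simps)
  ultimately show ?thesis
    by linarith
qed

text \<open>A three-circles estimate: the Taylor coefficients are bounded by the geometric mean of the two
  Cauchy bounds on the discs of radius \<open>\<rho> / 4\<close> and \<open>\<rho>\<close>.\<close>

lemma small_disc_enlarges:
  fixes f :: "complex \<Rightarrow> complex" and B \<mu> \<rho> :: real
  assumes f: "f analytic_on cball c \<rho>" and "0 < \<rho>" and "0 \<le> \<mu>"
    and B: "\<And>z. z \<in> cball c \<rho> \<Longrightarrow> norm (f z) \<le> B"
    and small: "\<And>z. z \<in> cball c (\<rho> / 4) \<Longrightarrow> norm (f z) \<le> 16 * B * exp (- 2 * \<mu>)"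
    and z: "z \<in> cball c (3 * \<rho> / 8)"
  shows "norm (f z) \<le> 16 * B * exp (- \<mu>)"
proof -
  define C where "C = (\<lambda>k. norm ((deriv ^^ k) f c) / fact k)"
  have B0: "0 \<le> B"
    using B[of c] assms(2) norm_ge_zero order_trans by (metis centre_in_cball less_imp_le)
  have coeff: "C k * s ^ k \<le> D"
    if "0 < s" "s \<le> \<rho>" and D: "\<And>z. z \<in> cball c s \<Longrightarrow> norm (f z) \<le> D" for s D k
  proof -
    have "f analytic_on cball c s"
      using f that by (auto intro: analytic_on_subset)
    then have hol: "f holomorphic_on cball c s"
      by (rule analytic_imp_holomorphic)
    have "norm ((deriv ^^ k) f c) \<le> fact k * D / s ^ k"
    proof (rule Cauchy_inequality)
      show "f holomorphic_on ball c s"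
        using hol holomorphic_on_subset ball_subset_cball by blast
      show "continuous_on (cball c s) f"
        using hol by (rule holomorphic_on_imp_continuous_on)
    qed (use that in \<open>auto simp: dist_norm\<close>)
    then show ?thesis
      using that(1) by (simp add: C_def field_simps)
  qed
  \<comment> \<open>The two Cauchy bounds are multiplied and the root is taken. The root turns 16
    into 4 and the geometric series of ratio 3/4 contributes another 4, so the constant 16
    reproduces itself and iteration affects only the exponent.\<close>
  have C_le: "C k * (3 * \<rho> / 8) ^ k \<le> 4 * B * exp (- \<mu>) * (3 / 4) ^ k" for k
  proof -
    define x where "x = C k * \<rho> ^ k"
    have x: "0 \<le> x" "x \<le> B"
      using coeff[of \<rho> B k] B assms(2) by (auto simp: x_def C_def)
    have "C k * (\<rho> / 4) ^ k \<le> 16 * B * exp (- 2 * \<mu>)"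
      using coeff[of "\<rho> / 4"] small assms(2) by auto
    then have "x \<le> 16 * B * exp (- 2 * \<mu>) * 4 ^ k"
      by (simp add: x_def power_divide field_simps)
    then have "x * x \<le> B * (16 * B * exp (- 2 * \<mu>) * 4 ^ k)"
      using x B0 by (intro mult_mono) auto
    also have "\<dots> = (4 * B * exp (- \<mu>) * 2 ^ k)\<^sup>2"
    proof -
      have "exp (- 2 * \<mu>) = (exp (- \<mu>))\<^sup>2"
        using exp_double[of "- \<mu>"] by simp
      moreover have "(4::real) ^ k = (2 ^ k)\<^sup>2"
        using power_mult_distrib[of "2::real" 2 k] by (simp add: power2_eq_square)
      ultimately show ?thesis
        by (simp add: power2_eq_square)
    qed
    finally have "x\<^sup>2 \<le> (4 * B * exp (- \<mu>) * 2 ^ k)\<^sup>2"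
      by (simp add: power2_eq_square)
    then have "x \<le> 4 * B * exp (- \<mu>) * 2 ^ k"
      by (rule power2_le_imp_le) (use B0 in auto)
    then have "x * (3 / 8) ^ k \<le> 4 * B * exp (- \<mu>) * 2 ^ k * (3 / 8) ^ k"
      by (intro mult_right_mono) auto
    moreover have "(2::real) ^ k * (3 / 8) ^ k = (3 / 4) ^ k"
      by (simp flip: power_mult_distrib)
    moreover have "x * (3 / 8) ^ k = C k * (3 * \<rho> / 8) ^ k"
      by (simp add: x_def power_mult_distrib power_divide)
    ultimately show ?thesis
      by (simp add: mult.assoc)
  qed
  have "f holomorphic_on ball c \<rho>"
    using f analytic_imp_holomorphic analytic_on_subset ball_subset_cball by blast
  then have sums: "(\<lambda>k. (deriv ^^ k) f c / fact k * (z - c) ^ k) sums f z"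
    by (rule holomorphic_power_series) (use z assms(2) in auto)
  have "norm (f z) \<le> (\<Sum>k. 4 * B * exp (- \<mu>) * (3 / 4) ^ k)"
    unfolding sums_unique[OF sums]
  proof (rule norm_suminf_le)
    show "summable (\<lambda>k. 4 * B * exp (- \<mu>) * (3 / 4) ^ k)"
      by (intro summable_mult summable_geometric) simp
    fix k
    have "norm ((deriv ^^ k) f c / fact k * (z - c) ^ k) = C k * norm (z - c) ^ k"
      by (simp add: C_def norm_mult norm_divide norm_power)
    also have "\<dots> \<le> C k * (3 * \<rho> / 8) ^ k"
      using z by (intro mult_left_mono power_mono) (auto simp: C_def dist_norm norm_minus_commute)
    finally show "norm ((deriv ^^ k) f c / fact k * (z - c) ^ k) \<le> 4 * B * exp (- \<mu>) * (3 / 4) ^ k"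
      using C_le[of k] by linarith
  qed
  also have "\<dots> = 16 * B * exp (- \<mu>)"
    by (simp add: suminf_mult suminf_geometric summable_geometric)
  finally show ?thesis .
qed

section \<open>Propagation of smallness along the interval\<close>

lemma cball_subset_rectangle:
  fixes t :: real
  assumes "\<bar>t\<bar> \<le> 1"
  shows "cball (complex_of_real t) \<rho> \<subseteq> rectangle \<rho>"
proof
  fix z assume "z \<in> cball (complex_of_real t) \<rho>"
  then have z: "norm (z - of_real t) \<le> \<rho>"
    by (simp add: dist_norm norm_minus_commute)
  have "\<bar>Re z - t\<bar> \<le> \<rho>" "\<bar>Im z\<bar> \<le> \<rho>"
    using z abs_Re_le_cmod[of "z - of_real t"] abs_Im_le_cmod[of "z - of_real t"] by auto
  then show "z \<in> rectangle \<rho>"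
    using assms by (auto simp: rectangle_def)
qed

text \<open>The inner disc travels from 0 to \<open>t\<close> in \<open>m\<close> moves of length at
  most \<rho> / 8. A disc of radius \<rho> / 4 about the new centre lies in the disc of radius 3
  \<rho> / 8 about the old one, and each move halves the exponent.\<close>

lemma smallness_propagates:
  fixes G :: "complex \<Rightarrow> complex" and B \<mu> \<rho> :: real
  assumes G: "G analytic_on rectangle \<rho>" and "0 < \<rho>" and "0 \<le> \<mu>"
    and B: "\<And>z. z \<in> rectangle \<rho> \<Longrightarrow> norm (G z) \<le> B"
    and small: "\<And>z. z \<in> cball 0 (\<rho> / 4) \<Longrightarrow> norm (G z) \<le> 16 * B * exp (- \<mu>)"
    and "\<bar>t\<bar> \<le> 1" and "\<bar>t\<bar> \<le> real m * \<rho> / 8" and "z \<in> cball (of_real t) (\<rho> / 4)"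
  shows "norm (G z) \<le> 16 * B * exp (- \<mu> / 2 ^ m)"
  using assms(6-)
proof (induction m arbitrary: t z)
  case 0
  then show ?case using small[of z] by simp
next
  case (Suc m)
  \<comment> \<open>The preceding centre: the segment from 0 to \<open>t\<close> is cut into
    \<open>Suc m\<close> equal moves and the last one is taken back.\<close>
  define t' where "t' = t * (real m / real (Suc m))"
  have factor: "0 \<le> real m / real (Suc m)" "real m / real (Suc m) \<le> 1"
    by auto
  have t': "\<bar>t'\<bar> \<le> 1"
    unfolding t'_def abs_mult using Suc.prems(1) factor
    by (metis abs_ge_zero abs_of_nonneg mult_le_one)
  have t'_m: "\<bar>t'\<bar> \<le> real m * \<rho> / 8"
  proof -
    have "\<bar>t'\<bar> = \<bar>t\<bar> * (real m / real (Suc m))"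
      unfolding t'_def abs_mult using factor by simp
    also have "\<dots> \<le> (real (Suc m) * \<rho> / 8) * (real m / real (Suc m))"
      using Suc.prems(2) factor by (intro mult_right_mono) auto
    also have "\<dots> = real m * \<rho> / 8"
      by (simp add: divide_simps del: of_nat_Suc)
    finally show ?thesis .
  qed
  have tt': "\<bar>t - t'\<bar> \<le> \<rho> / 8"
  proof -
    have "t - t' = t / real (Suc m)"
      by (simp add: t'_def field_simps)
    then show ?thesis
      using Suc.prems(2) by (simp add: divide_le_eq mult.commute)
  qed
  have "norm (G z) \<le> 16 * B * exp (- (\<mu> / 2 ^ Suc m))"
  proof (rule small_disc_enlarges[where f = G and z = z])
    show "G analytic_on cball (of_real t') \<rho>"
      using G analytic_on_subset cball_subset_rectangle[OF t'] by blast
    show "norm (G w) \<le> B" if "w \<in> cball (of_real t') \<rho>" for w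
      using that B cball_subset_rectangle[OF t'] by blast
    show "norm (G w) \<le> 16 * B * exp (- 2 * (\<mu> / 2 ^ Suc m))" if "w \<in> cball (of_real t') (\<rho> / 4)" for w
      using Suc.IH[OF t' t'_m that] by simp
    have "dist (of_real t') z \<le> dist (complex_of_real t') (of_real t) + dist (of_real t) z"
      by (rule dist_triangle)
    also have "dist (complex_of_real t') (of_real t) \<le> \<rho> / 8"
      using tt' by (simp add: dist_norm abs_minus_commute flip: of_real_diff)
    finally show "z \<in> cball (of_real t') (3 * \<rho> / 8)"
      using Suc.prems(3) by simp
  qed (use assms in auto)
  then show ?case by simp
qed

text \<open>The constant \<open>c\<close> depends on \<rho> and \<open>b\<close> alone, so the
  number of nodes is linear in \<open>L\<close>, which later is the logarithm of
  \<open>Q * n / \<omega>\<close>.\<close>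

lemma extrapolation:
  fixes \<rho> b :: real
  assumes \<rho>: "0 < \<rho>" "\<rho> \<le> 1" and b: "1 \<le> b"
  obtains c where "0 < c"
    and "\<And>(G :: complex \<Rightarrow> complex) K L r e t. G analytic_on rectangle \<rho> \<Longrightarrow> 1 \<le> L \<Longrightarrow> c * L \<le> real K \<Longrightarrow>
      (\<And>z. z \<in> rectangle \<rho> \<Longrightarrow> norm (G z) \<le> b * exp L) \<Longrightarrow>
      r \<noteq> 0 \<Longrightarrow> \<bar>r\<bar> \<le> \<rho> / 16 \<Longrightarrow>
      (\<And>j. j < K \<Longrightarrow> norm (G (of_real (r * real j / real K))) \<le> e) \<Longrightarrow>
      e * (36 / \<bar>r\<bar>) ^ K \<le> 1 \<Longrightarrow> \<bar>t\<bar> \<le> 1 \<Longrightarrow> norm (G (of_real t)) \<le> exp (- L) / 8"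
proof -
  \<comment> \<open>\<open>m\<close> moves of length \<rho> / 8 reach all of [-1, 1]. The exponent
    that survives is \<open>K / 2 ^ m \<ge> 2 * L + ln (128 * b)\<close>: one \<open>L\<close>
    cancels the growth \<open>exp L\<close> of the bound, the other is the gain, and 128 = 16 * 8
    covers the 16 of the chain and the final 8.\<close>
  define m where "m = nat \<lceil>8 / \<rho>\<rceil>"
  define c where "c = 2 ^ m * (2 + ln (128 * b))"
  have lnb: "0 \<le> ln (128 * b)"
    using b by simp
  have c: "0 < c"
    unfolding c_def using lnb by (intro mult_pos_pos) auto
  have m: "8 / \<rho> \<le> real m"
    unfolding m_def by linarith
  have "norm (G (of_real t)) \<le> exp (- L) / 8"
    if G: "G analytic_on rectangle \<rho>" and L: "1 \<le> L" and K: "c * L \<le> real K"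
      and B: "\<And>z. z \<in> rectangle \<rho> \<Longrightarrow> norm (G z) \<le> b * exp L"
      and r: "r \<noteq> 0" "\<bar>r\<bar> \<le> \<rho> / 16"
      and e: "\<And>j. j < K \<Longrightarrow> norm (G (of_real (r * real j / real K))) \<le> e"
      and small: "e * (36 / \<bar>r\<bar>) ^ K \<le> 1" and t: "\<bar>t\<bar> \<le> 1"
    for G :: "complex \<Rightarrow> complex" and K L r e t
  proof -
    define B' where "B' = b * exp L"
    have B': "1 \<le> B'"
      unfolding B'_def using b L by (metis mult_mono one_le_exp_iff less_imp_le zero_le_one order_trans mult_1 zero_less_one)
    have K0: "0 < K"
      using K c L by (metis less_le_trans mult_pos_pos of_nat_0_less_iff zero_less_one)
    have sub: "cball 0 \<rho> \<subseteq> rectangle \<rho>"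
      using cball_subset_rectangle[of 0] by simp
    have near: "norm (G z) \<le> 16 * B' * exp (- real K)" if z: "z \<in> cball 0 (\<rho> / 4)" for z
    proof -
      have "norm (G z) \<le> (B' + 2) / 3 ^ K"
      proof (rule small_at_samples_imp_small_near[where G = G and z = z])
        show "G analytic_on cball 0 \<rho>"
          using G sub analytic_on_subset by blast
        show "norm (G w) \<le> B'" if "w \<in> cball 0 \<rho>" for w
          using that B sub unfolding B'_def by blast
      qed (use \<rho> r K0 e small z in auto)
      also have "\<dots> \<le> 16 * B' * exp (- real K)"
      proof -
        have "exp (real K) = exp 1 ^ K"
          using exp_of_nat_mult[of K "1::real"] by simp
        also have "\<dots> \<le> 3 ^ K"
          by (intro power_mono exp_le) simp
        finally have "1 / 3 ^ K \<le> exp (- real K)"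
          by (simp add: exp_minus field_simps)
        then have "(B' + 2) * (1 / 3 ^ K) \<le> (16 * B') * exp (- real K)"
          using B' by (intro mult_mono) auto
        then show ?thesis by simp
      qed
      finally show ?thesis .
    qed
    have "norm (G (of_real t)) \<le> 16 * B' * exp (- real K / 2 ^ m)"
    proof (rule smallness_propagates[OF G \<rho>(1)])
      have "1 \<le> real m * \<rho> / 8"
        using m \<rho> by (simp add: divide_le_eq)
      then show "\<bar>t\<bar> \<le> real m * \<rho> / 8"
        using t by linarith
    qed (use near B t \<rho> in \<open>auto simp: B'_def\<close>)
    also have "exp (- real K / 2 ^ m) \<le> exp (- 2 * L - ln (128 * b))"
    proof -
      have "2 ^ m * (2 * L + ln (128 * b)) \<le> 2 ^ m * ((2 + ln (128 * b)) * L)"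
        using L lnb mult_left_mono[of 1 L "ln (128 * b)"] by (simp add: algebra_simps)
      also have "\<dots> \<le> real K"
        using K by (simp add: c_def mult.assoc)
      finally show ?thesis
        by (simp add: field_simps)
    qed
    also have "\<dots> = exp (- L) * exp (- L) / (128 * b)"
      using b by (simp add: exp_diff flip: exp_add)
    finally have "norm (G (of_real t)) \<le> 16 * B' * (exp (- L) * exp (- L) / (128 * b))"
      using B' by simp
    also have "\<dots> = exp (- L) / 8"
      using b by (simp add: B'_def exp_minus field_simps)
    finally show ?thesis .
  qed
  with c show ?thesis
    by (rule that)
qed

section \<open>Cauchy and Taylor estimates for profiles\<close>

lemma norm_higher_deriv_le:
  assumes "\<phi> \<in> analytic_class \<sigma> Q" and "0 < s" and "cball z s \<subseteq> rectangle \<sigma>"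
  shows "norm ((deriv ^^ k) \<phi> z) \<le> fact k * Q / s ^ k"
proof (rule Cauchy_inequality)
  have "\<phi> analytic_on cball z s"
    using assms analytic_on_subset by (auto simp: analytic_class_def)
  then have hol: "\<phi> holomorphic_on cball z s"
    by (rule analytic_imp_holomorphic)
  then show "\<phi> holomorphic_on ball z s"
    using holomorphic_on_subset ball_subset_cball by blast
  show "continuous_on (cball z s) \<phi>"
    using hol by (rule holomorphic_on_imp_continuous_on)
  show "norm (\<phi> w) \<le> Q" if "norm (z - w) = s" for w
    using that assms by (auto simp: analytic_class_def dist_norm subset_iff)
qed (use assms in auto)

text \<open>Half of the margin is given up: Cauchy's estimate with radius \<sigma> / 2 then bounds
  the derivative by 2 Q / \<sigma> on a complex neighbourhood, as its extrapolation
  requires.\<close>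

lemma cball_half_subset_rectangle:
  assumes "z \<in> rectangle (\<sigma> / 2)"
  shows "cball z (\<sigma> / 2) \<subseteq> rectangle \<sigma>"
proof
  fix w assume "w \<in> cball z (\<sigma> / 2)"
  then have w: "norm (w - z) \<le> \<sigma> / 2"
    by (simp add: dist_norm norm_minus_commute)
  show "w \<in> rectangle \<sigma>"
    using assms w abs_Re_le_cmod[of "w - z"] abs_Im_le_cmod[of "w - z"]
    by (auto simp: rectangle_def)
qed

lemma of_real_in_rectangle: "0 \<le> \<sigma> \<Longrightarrow> \<bar>t\<bar> \<le> 1 \<Longrightarrow> complex_of_real t \<in> rectangle \<sigma>"
  by (simp add: rectangle_def)

lemma rectangle_mono: "s \<le> \<sigma> \<Longrightarrow> rectangle s \<subseteq> rectangle \<sigma>"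
  by (auto simp: rectangle_def)

lemma of_real_real_trace:
  assumes "\<phi> \<in> analytic_class \<sigma> Q" and "0 \<le> \<sigma>" and "\<bar>t\<bar> \<le> 1"
  shows "complex_of_real (real_trace \<phi> t) = \<phi> (of_real t)"
  using assms of_real_in_rectangle[of \<sigma> t]
  by (auto simp: analytic_class_def real_trace_def of_real_Re)

text \<open>Reflecting the profile and negating the direction leaves a ridge function unchanged;
  this symmetry absorbs the sign that the gradient leaves open.\<close>

lemma analytic_class_reflect:
  assumes "\<phi> \<in> analytic_class \<sigma> Q"
  shows "(\<lambda>z. \<phi> (- z)) \<in> analytic_class \<sigma> Q"
proof -
  have neg: "- z \<in> rectangle \<sigma>" if "z \<in> rectangle \<sigma>" for z
    using that by (auto simp: rectangle_def)
  have "(\<phi> \<circ> uminus) analytic_on rectangle \<sigma>"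
    by (rule analytic_on_compose_gen[where T = "rectangle \<sigma>"])
      (use assms neg in \<open>auto simp: analytic_class_def intro!: analytic_intros\<close>)
  then show ?thesis
    using assms neg by (auto simp: analytic_class_def comp_def)
qed

lemma convex_real_interval: "convex (complex_of_real ` {-1..1})"
  by (intro convex_linear_image convex_real_interval linear_of_real)

lemma has_field_derivative_on_interval:
  assumes "\<phi> \<in> analytic_class \<sigma> Q" and "0 \<le> \<sigma>" and "\<bar>t\<bar> \<le> 1"
  shows "((deriv ^^ k) \<phi> has_field_derivative (deriv ^^ Suc k) \<phi> (of_real t)) (at (of_real t) within S)"
proof -
  have "(deriv ^^ k) \<phi> analytic_on rectangle \<sigma>"
    using assms by (auto simp: analytic_class_def intro: analytic_higher_deriv)
  then have "(deriv ^^ k) \<phi> field_differentiable at (of_real t)"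
    using of_real_in_rectangle[OF assms(2,3)] analytic_on_imp_differentiable_at by blast
  then show ?thesis
    using field_differentiable_derivI has_field_derivative_at_within by fastforce
qed

lemma lipschitz_on_interval:
  assumes "\<phi> \<in> analytic_class \<sigma> Q" and "0 \<le> \<sigma>"
    and "\<And>t. \<bar>t\<bar> \<le> 1 \<Longrightarrow> norm (deriv \<phi> (of_real t)) \<le> D"
    and "\<bar>t\<bar> \<le> 1" and "\<bar>u\<bar> \<le> 1"
  shows "norm (\<phi> (of_real t) - \<phi> (of_real u)) \<le> D * \<bar>t - u\<bar>"
proof -
  have "norm (\<phi> (of_real t) - \<phi> (of_real u)) \<le> D * norm (complex_of_real t - of_real u)"
  proof (rule field_differentiable_bound[OF convex_real_interval, where f' = "deriv \<phi>"])
    fix z assume "z \<in> complex_of_real ` {-1..1}"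
    then obtain v where v: "z = of_real v" "\<bar>v\<bar> \<le> 1"
      by auto
    show "(\<phi> has_field_derivative deriv \<phi> z) (at z within complex_of_real ` {-1..1})"
      using has_field_derivative_on_interval[OF assms(1,2) v(2), of 0] v by simp
    show "norm (deriv \<phi> z) \<le> D"
      using assms(3) v by simp
  qed (use assms in \<open>auto simp: abs_le_iff intro!: imageI\<close>)
  then show ?thesis
    by (simp flip: of_real_diff)
qed

lemma norm_deriv_le:
  assumes "\<phi> \<in> analytic_class \<sigma> Q" and "0 < \<sigma>" and "\<bar>t\<bar> \<le> 1"
  shows "norm (deriv \<phi> (of_real t)) \<le> Q / \<sigma>"
  using norm_higher_deriv_le[OF assms(1,2) cball_subset_rectangle[OF assms(3)], of 1] by simp

lemma taylor_on_interval:
  assumes "\<phi> \<in> analytic_class \<sigma> Q" and "0 < \<sigma>" and "\<bar>u\<bar> \<le> 1" and "\<bar>u + s\<bar> \<le> 1"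
  shows "norm (\<phi> (of_real (u + s)) - \<phi> (of_real u) - of_real s * deriv \<phi> (of_real u)) \<le> 2 * Q / \<sigma>\<^sup>2 * s\<^sup>2"
proof -
  let ?S = "complex_of_real ` {-1..1}"
  \<comment> \<open>The remainder in \<open>complex_Taylor\<close> is divided by
    \<open>fact 1\<close>, so the factor 2 from Cauchy's bound on the second derivative
    stays.\<close>
  have "norm ((deriv ^^ 0) \<phi> (of_real (u + s))
      - (\<Sum>i\<le>1. (deriv ^^ i) \<phi> (of_real u) * (of_real (u + s) - of_real u) ^ i / fact i))
      \<le> (2 * Q / \<sigma>\<^sup>2) * norm (complex_of_real (u + s) - of_real u) ^ Suc 1 / fact 1"
  proof (rule complex_Taylor[OF convex_real_interval])
    fix i z assume "z \<in> ?S"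
    then obtain v where v: "z = of_real v" "\<bar>v\<bar> \<le> 1"
      by auto
    show "((deriv ^^ i) \<phi> has_field_derivative (deriv ^^ Suc i) \<phi> z) (at z within ?S)"
      unfolding v(1) using has_field_derivative_on_interval[OF assms(1) _ v(2)] assms(2) by simp
  next
    fix z assume "z \<in> ?S"
    then obtain v where v: "z = of_real v" "\<bar>v\<bar> \<le> 1"
      by auto
    show "norm ((deriv ^^ Suc 1) \<phi> z) \<le> 2 * Q / \<sigma>\<^sup>2"
      unfolding v(1)
      using norm_higher_deriv_le[OF assms(1,2) cball_subset_rectangle[OF v(2)], of "Suc 1"]
      by (simp add: power2_eq_square fact_2)
  qed (use assms in \<open>auto simp: abs_le_iff simp del: of_real_add intro!: imageI\<close>)
  then show ?thesis
    by (simp add: algebra_simps power2_eq_square flip: abs_mult)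
qed

text \<open>Answer errors \<open>Q * h\<^sup>2\<close> have the order of the Taylor remainder, so
  after division by the step \<open>h\<close> both contribute order \<open>h\<close>.\<close>

lemma difference_quotient_close:
  assumes \<phi>: "\<phi> \<in> analytic_class \<sigma> Q" and \<sigma>: "0 < \<sigma>" "\<sigma> \<le> 1" and "0 \<le> Q"
    and u: "\<bar>u\<bar> \<le> 1" "\<bar>u + h * c\<bar> \<le> 1" and c: "\<bar>c\<bar> \<le> 1" and h: "0 < h"
    and y: "\<bar>y - real_trace \<phi> u\<bar> \<le> Q * h\<^sup>2" and y': "\<bar>y' - real_trace \<phi> (u + h * c)\<bar> \<le> Q * h\<^sup>2"
  shows "norm (of_real ((y' - y) / h) - of_real c * deriv \<phi> (of_real u)) \<le> 4 * Q * h / \<sigma>\<^sup>2"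
proof -
  let ?R = "\<phi> (of_real (u + h * c)) - \<phi> (of_real u) - of_real (h * c) * deriv \<phi> (of_real u)"
  have "norm ?R \<le> 2 * Q / \<sigma>\<^sup>2 * (h * c)\<^sup>2"
    by (rule taylor_on_interval[OF \<phi> \<sigma>(1) u])
  also have "\<dots> \<le> 2 * Q / \<sigma>\<^sup>2 * h\<^sup>2"
    using c \<open>0 \<le> Q\<close> mult_left_mono[of "c\<^sup>2" 1 "h\<^sup>2"]
    by (intro mult_left_mono) (auto simp: power_mult_distrib abs_square_le_1)
  finally have R: "norm ?R \<le> 2 * Q / \<sigma>\<^sup>2 * h\<^sup>2" .
  have y1: "norm (of_real y - \<phi> (of_real u)) \<le> Q * h\<^sup>2"
    using y unfolding of_real_real_trace[OF \<phi> less_imp_le[OF \<sigma>(1)] u(1), symmetric]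
    by (simp flip: of_real_diff)
  have y2: "norm (of_real y' - \<phi> (of_real (u + h * c))) \<le> Q * h\<^sup>2"
    using y' unfolding of_real_real_trace[OF \<phi> less_imp_le[OF \<sigma>(1)] u(2), symmetric]
    by (simp flip: of_real_diff)
  have "complex_of_real h * of_real ((y' - y) / h) = of_real y' - of_real y"
    unfolding of_real_mult[symmetric] of_real_diff[symmetric] using h by simp
  then have "of_real h * (of_real ((y' - y) / h) - of_real c * deriv \<phi> (of_real u))
      = ?R + (of_real y' - \<phi> (of_real (u + h * c))) - (of_real y - \<phi> (of_real u))"
    by (simp add: right_diff_distrib mult.assoc)
  then have "h * norm (of_real ((y' - y) / h) - of_real c * deriv \<phi> (of_real u))
      = norm (?R + (of_real y' - \<phi> (of_real (u + h * c))) - (of_real y - \<phi> (of_real u)))"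
    using h by (metis norm_mult norm_of_real abs_of_pos)
  also have "\<dots> \<le> 2 * Q / \<sigma>\<^sup>2 * h\<^sup>2 + Q * h\<^sup>2 + Q * h\<^sup>2"
    using norm_triangle_ineq4[of "?R + (of_real y' - \<phi> (of_real (u + h * c)))" "of_real y - \<phi> (of_real u)"]
      norm_triangle_ineq[of ?R "of_real y' - \<phi> (of_real (u + h * c))"] R y1 y2 by linarith
  also have "\<dots> \<le> h * (4 * Q * h / \<sigma>\<^sup>2)"
  proof -
    have "1 \<le> 1 / \<sigma>\<^sup>2"
      using \<sigma> by (simp add: power_le_one)
    then have "2 * Q * h\<^sup>2 * 1 \<le> 2 * Q * h\<^sup>2 * (1 / \<sigma>\<^sup>2)"
      using \<open>0 \<le> Q\<close> by (intro mult_left_mono) auto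
    moreover have "2 * Q / \<sigma>\<^sup>2 * h\<^sup>2 = 2 * Q * h\<^sup>2 * (1 / \<sigma>\<^sup>2)"
      "h * (4 * Q * h / \<sigma>\<^sup>2) = 2 * (2 * Q * h\<^sup>2 * (1 / \<sigma>\<^sup>2))"
      by (simp_all add: power2_eq_square)
    ultimately show ?thesis
      by linarith
  qed
  finally show ?thesis
    using h by (rule mult_left_le_imp_le)
qed

section \<open>Directions: components, norms, scalar products\<close>

lemma abs_component_le: "k < n \<Longrightarrow> \<bar>x k\<bar> \<le> norm_n n x"
  using member_le_L2_set[of "{..<n}" k "\<lambda>k. \<bar>x k\<bar>"] by (simp add: norm_n_def L2_set_def)

text \<open>The measured gradient \<open>d\<close> is nearly a multiple of both unit vectors. Taking
  norms shows that \<bar>\<mu>\<bar> and \<bar>\<nu>\<bar> nearly agree; with the sign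
  \<open>s\<close> chosen so that \<open>s * \<mu>\<close> is close to \<nu>, the vector
  \<open>\<mu> * (a - s * a')\<close> is small, and \<bar>\<mu>\<bar> \<ge> \<tau> permits
  division.\<close>

lemma proportional_unit_vectors_close:
  fixes a a' d :: "nat \<Rightarrow> real"
  assumes unit: "norm_n n a = 1" "norm_n n a' = 1" and n: "0 < n" and "0 < \<tau>" and \<mu>: "\<tau> \<le> \<bar>\<mu>\<bar>"
    and d: "\<And>k. k < n \<Longrightarrow> \<bar>d k - \<mu> * a k\<bar> \<le> \<eta>" and d': "\<And>k. k < n \<Longrightarrow> \<bar>d k - \<nu> * a' k\<bar> \<le> \<eta>"
  obtains s :: real where "s = 1 \<or> s = -1" and "\<And>k. k < n \<Longrightarrow> \<bar>a k - s * a' k\<bar> \<le> 4 * \<eta> * n / \<tau>"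
proof -
  have \<eta>: "0 \<le> \<eta>"
    using d[OF n] by linarith
  have diff: "\<bar>\<mu> * a k - \<nu> * a' k\<bar> \<le> 2 * \<eta>" if "k < n" for k
    using d[OF that] d'[OF that] by linarith
  have L2_diff: "L2_set (\<lambda>k. \<mu> * a k - \<nu> * a' k) {..<n} \<le> 2 * \<eta> * n"
  proof -
    have "L2_set (\<lambda>k. \<mu> * a k - \<nu> * a' k) {..<n} \<le> (\<Sum>k<n. \<bar>\<mu> * a k - \<nu> * a' k\<bar>)"
      by (rule L2_set_le_sum_abs)
    also have "\<dots> \<le> (\<Sum>k<n. 2 * \<eta>)"
      using diff by (intro sum_mono) auto
    finally show ?thesis by (simp add: mult_ac)
  qed
  have scale: "L2_set (\<lambda>k. c * b k) {..<n} = \<bar>c\<bar>" if "norm_n n b = 1" for c and b :: "nat \<Rightarrow> real"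
  proof -
    have "L2_set (\<lambda>k. \<bar>c\<bar> * b k) {..<n} = \<bar>c\<bar>"
      using that L2_set_right_distrib[of "\<bar>c\<bar>" b "{..<n}"] by (simp add: norm_n_def)
    then show ?thesis
      by (simp add: L2_set_def power_mult_distrib)
  qed
  have lam: "\<bar>\<bar>\<mu>\<bar> - \<bar>\<nu>\<bar>\<bar> \<le> 2 * \<eta> * n"
  proof -
    have "L2_set (\<lambda>k. \<mu> * a k) {..<n} \<le> L2_set (\<lambda>k. \<nu> * a' k) {..<n} + L2_set (\<lambda>k. \<mu> * a k - \<nu> * a' k) {..<n}"
      using L2_set_triangle_ineq[of "\<lambda>k. \<nu> * a' k" "\<lambda>k. \<mu> * a k - \<nu> * a' k" "{..<n}"] by simp
    moreover have "L2_set (\<lambda>k. \<nu> * a' k) {..<n} \<le> L2_set (\<lambda>k. \<mu> * a k) {..<n} + L2_set (\<lambda>k. \<nu> * a' k - \<mu> * a k) {..<n}"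
      using L2_set_triangle_ineq[of "\<lambda>k. \<mu> * a k" "\<lambda>k. \<nu> * a' k - \<mu> * a k" "{..<n}"] by simp
    moreover have "L2_set (\<lambda>k. \<nu> * a' k - \<mu> * a k) {..<n} = L2_set (\<lambda>k. \<mu> * a k - \<nu> * a' k) {..<n}"
      by (simp add: L2_set_def power2_commute)
    ultimately show ?thesis
      using L2_diff scale[OF unit(1)] scale[OF unit(2)] by auto
  qed
  define s :: real where "s = (if 0 \<le> \<mu> * \<nu> then 1 else -1)"
  have s: "\<bar>\<nu> - s * \<mu>\<bar> = \<bar>\<bar>\<mu>\<bar> - \<bar>\<nu>\<bar>\<bar>"
    by (auto simp: s_def zero_le_mult_iff abs_if)
  have "\<bar>a k - s * a' k\<bar> \<le> 4 * \<eta> * n / \<tau>" if k: "k < n" for k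
  proof -
    have a'k: "\<bar>a' k\<bar> \<le> 1"
      using abs_component_le[OF k, of a'] unit(2) by simp
    have "\<tau> * \<bar>a k - s * a' k\<bar> \<le> \<bar>\<mu>\<bar> * \<bar>a k - s * a' k\<bar>"
      using \<mu> by (intro mult_right_mono) auto
    also have "\<dots> = \<bar>(\<mu> * a k - \<nu> * a' k) + (\<nu> - s * \<mu>) * a' k\<bar>"
      unfolding abs_mult[symmetric] by (simp add: algebra_simps)
    also have "\<dots> \<le> \<bar>\<mu> * a k - \<nu> * a' k\<bar> + \<bar>\<nu> - s * \<mu>\<bar> * \<bar>a' k\<bar>"
      unfolding abs_mult[symmetric] by (rule abs_triangle_ineq)
    also have "\<dots> \<le> 2 * \<eta> + (2 * \<eta> * n) * 1"
      using diff[OF k] lam s a'k \<eta> by (intro add_mono mult_mono) auto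
    also have "\<dots> \<le> 4 * \<eta> * n"
      using n mult_left_mono[of 1 "real n" "2 * \<eta>"] \<eta> by simp
    finally show ?thesis
      using \<open>0 < \<tau>\<close> by (simp add: pos_le_divide_eq mult.commute)
  qed
  moreover have "s = 1 \<or> s = -1"
    by (simp add: s_def)
  ultimately show ?thesis
    using that by blast
qed

lemma abs_scalar_prod_le:
  assumes "\<And>k. k < n \<Longrightarrow> \<bar>b k\<bar> \<le> \<alpha>" and "norm_n n x \<le> 1"
  shows "\<bar>scalar_prod_n n b x\<bar> \<le> n * \<alpha>"
proof -
  have x: "\<bar>x k\<bar> \<le> 1" if "k < n" for k
    using abs_component_le[OF that, of x] assms(2) by simp
  have "\<bar>scalar_prod_n n b x\<bar> \<le> (\<Sum>k<n. \<bar>b k\<bar> * \<bar>x k\<bar>)"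
    unfolding scalar_prod_n_def abs_mult[symmetric] by (rule sum_abs)
  also have "\<dots> \<le> (\<Sum>k<n. \<alpha> * 1)"
  proof (rule sum_mono)
    fix k assume "k \<in> {..<n}"
    then show "\<bar>b k\<bar> * \<bar>x k\<bar> \<le> \<alpha> * 1"
      using assms(1)[of k] x[of k] by (intro mult_mono) auto
  qed
  finally show ?thesis by simp
qed

lemma abs_scalar_prod_unit_le:
  assumes "norm_n n a = 1" and "norm_n n x \<le> 1"
  shows "\<bar>scalar_prod_n n a x\<bar> \<le> 1"
proof -
  have "\<bar>scalar_prod_n n a x\<bar> \<le> (\<Sum>k<n. \<bar>a k\<bar> * \<bar>x k\<bar>)"
    unfolding scalar_prod_n_def abs_mult[symmetric] by (rule sum_abs)
  also have "\<dots> \<le> norm_n n a * norm_n n x"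
    unfolding norm_n_def by (rule L2_set_mult_ineq)
  finally show ?thesis
    using assms by simp
qed

text \<open>The bound \<open>1 / n\<close>, cruder than the optimal 1 / sqrt n, costs only a
  constant, because \<open>n\<close> enters the final exponent as \<open>ln n\<close>.\<close>

lemma large_component:
  assumes "norm_n n a = 1"
  obtains k where "k < n" and "1 / n \<le> \<bar>a k\<bar>"
proof (rule ccontr)
  assume "\<not> thesis"
  with that have small: "\<bar>a k\<bar> < 1 / n" if "k < n" for k
    using that by force
  have n: "0 < n"
    using assms by (cases n) (auto simp: norm_n_def)
  have "norm_n n a \<le> (\<Sum>k<n. \<bar>a k\<bar>)"
    unfolding norm_n_def by (rule L2_set_le_sum_abs)
  also have "\<dots> < (\<Sum>k<n. 1 / n)"
    using small n by (intro sum_strict_mono) auto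
  also have "\<dots> = 1"
    using n by simp
  finally show False
    using assms by simp
qed

lemma flat_index_less:
  assumes "i < n" and "j < K"
  shows "i * K + j < n * (K :: nat)"
proof -
  have "i * K + j < Suc i * K"
    using assms by simp
  also have "\<dots> \<le> n * K"
    using assms by (intro mult_le_mono1) simp
  finally show ?thesis .
qed

section \<open>Recovery from noisy answers: step size and extrapolation\<close>

text \<open>Difference quotients are taken with step \<open>T\<^sup>2\<close> and compared with the threshold \<open>T\<close>;
  answers carry errors up to \<open>Q * T ^ 4\<close>. The factor \<open>Y\<close> bounds the amplification of errors by the
  interpolation at \<open>K\<close> nodes.\<close>

locale recovery =
  fixes \<sigma> Q \<omega> T Y :: real and n K :: nat
  assumes \<sigma>: "0 < \<sigma>" "\<sigma> \<le> 1" and Q: "1 \<le> Q" and \<omega>: "0 < \<omega>" "\<omega> < 1 / 2" and n: "1 \<le> n"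
    and K: "0 < K" and T: "0 < T" and Y: "(1152 * real n / \<sigma>) ^ K \<le> Y" "1 \<le> Y"
    and T_small: "T * (1000 * Q\<^sup>2 * real n ^ 2 / (\<sigma> ^ 4 * \<omega>) * Y) \<le> 1"
    and extrapolate: "\<And>(G :: complex \<Rightarrow> complex) r e t. G analytic_on rectangle (\<sigma> / 2) \<Longrightarrow>
      (\<And>z. z \<in> rectangle (\<sigma> / 2) \<Longrightarrow> norm (G z) \<le> 2 * Q / \<sigma>) \<Longrightarrow>
      r \<noteq> 0 \<Longrightarrow> \<bar>r\<bar> \<le> \<sigma> / 32 \<Longrightarrow>
      (\<And>j. j < K \<Longrightarrow> norm (G (of_real (r * real j / real K))) \<le> e) \<Longrightarrow>
      e * (36 / \<bar>r\<bar>) ^ K \<le> 1 \<Longrightarrow> \<bar>t\<bar> \<le> 1 \<Longrightarrow> norm (G (of_real t)) \<le> \<omega> / 8"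
begin

text \<open>The range \<sigma> / 32 is \<rho> / 16 for \<rho> = \<sigma> / 2, and multiplication by
  a component of a unit vector does not enlarge it. \<open>node 0\<close> is the origin.\<close>

definition node :: "nat \<Rightarrow> real" where
  "node j = \<sigma> / 32 * (real j / real K)"

lemma node_bounds: "j < K \<Longrightarrow> 0 \<le> node j \<and> node j \<le> \<sigma> / 32"
  using \<sigma> K mult_left_mono[of "real j / real K" 1 "\<sigma> / 32"] by (auto simp: node_def)

lemma abs_mult_node_le: "\<bar>c\<bar> \<le> 1 \<Longrightarrow> j < K \<Longrightarrow> \<bar>c * node j\<bar> \<le> 1 / 32"
  using node_bounds[of j] \<sigma> mult_mono[of "\<bar>c\<bar>" 1 "\<bar>node j\<bar>" "1 / 32"] by (simp add: abs_mult)

abbreviation W :: real where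
  "W \<equiv> 1000 * Q\<^sup>2 * real n ^ 2 / (\<sigma> ^ 4 * \<omega>) * Y"

lemma T_mult_le: "x \<le> W \<Longrightarrow> T * x \<le> 1"
  using T_small T by (meson dual_order.trans mult_left_mono less_imp_le)

text \<open>The smallness demands on \<open>T\<close> have the form \<open>T\<close> times such a
  monomial, with a factor \<open>Y\<close> where errors are extrapolated or
  \<open>1 / \<omega>\<close> where accuracy is at stake. \<open>W\<close> dominates all of them, so
  the one assumption \<open>T_small\<close> serves each through \<open>T_mult_le\<close>.\<close>

lemma monomial_le:
  assumes "i \<le> 2" "j \<le> 2" "k \<le> 4" and "0 \<le> x" "x \<le> 1000"
  shows "x * Q ^ i * real n ^ j / \<sigma> ^ k * Y \<le> W" "x * Q ^ i * real n ^ j / \<sigma> ^ k / \<omega> \<le> W"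
proof -
  have inv: "1 / \<sigma> ^ k \<le> 1 / \<sigma> ^ 4"
    using \<sigma> assms by (intro divide_left_mono power_decreasing) auto
  have "x * Q ^ i * real n ^ j * (1 / \<sigma> ^ k) \<le> 1000 * Q ^ 2 * real n ^ 2 * (1 / \<sigma> ^ 4)"
    using Q n \<sigma> assms inv by (intro mult_mono power_increasing) auto
  then have base: "x * Q ^ i * real n ^ j / \<sigma> ^ k \<le> 1000 * Q ^ 2 * real n ^ 2 / \<sigma> ^ 4"
    by simp
  have pos: "0 \<le> 1000 * Q ^ 2 * real n ^ 2 / \<sigma> ^ 4"
    using \<sigma> by auto
  have "x * Q ^ i * real n ^ j / \<sigma> ^ k * Y \<le> 1000 * Q ^ 2 * real n ^ 2 / \<sigma> ^ 4 * Y * (1 / \<omega>)"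
    using base pos Y \<omega> mult_left_mono[of 1 "1 / \<omega>" "1000 * Q ^ 2 * real n ^ 2 / \<sigma> ^ 4 * Y"]
    by (smt (verit) mult_right_mono mult_nonneg_nonneg le_divide_eq_1_pos mult.right_neutral)
  then show "x * Q ^ i * real n ^ j / \<sigma> ^ k * Y \<le> W"
    by (simp add: field_simps)
  have "x * Q ^ i * real n ^ j / \<sigma> ^ k * (1 / \<omega>) \<le> 1000 * Q ^ 2 * real n ^ 2 / \<sigma> ^ 4 * (1 / \<omega>)"
    using base \<omega> by (intro mult_right_mono) auto
  also have "\<dots> \<le> 1000 * Q ^ 2 * real n ^ 2 / \<sigma> ^ 4 * (1 / \<omega>) * Y"
    using mult_left_mono[of 1 Y "1000 * Q ^ 2 * real n ^ 2 / \<sigma> ^ 4 * (1 / \<omega>)"] pos Y \<omega> by auto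
  finally show "x * Q ^ i * real n ^ j / \<sigma> ^ k / \<omega> \<le> W"
    by (simp add: field_simps)
qed

lemma T_le: "T \<le> 1 / 1000"
proof -
  have "T * (1000 * Q ^ 0 * real n ^ 0 / \<sigma> ^ 0 * Y) \<le> 1"
    by (intro T_mult_le monomial_le) auto
  moreover have "T * 1 \<le> T * Y"
    using T Y by (intro mult_left_mono) auto
  ultimately show ?thesis
    by simp
qed

text \<open>Here \<open>c\<close> is a component of the direction and
  \<open>r = c * (\<sigma> / 32)\<close>. With \<open>\<bar>c\<bar> \<ge> 1 / n\<close> the
  amplification base is at most 36 * 32 * n / \<sigma> = 1152 * n / \<sigma>, the one that
  \<open>Y\<close> absorbs.\<close>

lemma extrapolate_along_axis:
  assumes "G analytic_on rectangle (\<sigma> / 2)"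
    and "\<And>z. z \<in> rectangle (\<sigma> / 2) \<Longrightarrow> norm (G z) \<le> 2 * Q / \<sigma>"
    and c: "1 / n \<le> \<bar>c\<bar>" "\<bar>c\<bar> \<le> 1"
    and e: "\<And>j. j < K \<Longrightarrow> norm (G (of_real (c * node j))) \<le> e" and "e * Y \<le> 1" and "\<bar>t\<bar> \<le> 1"
  shows "norm (G (of_real t)) \<le> \<omega> / 8"
proof (rule extrapolate[where r = "c * (\<sigma> / 32)" and e = e, OF assms(1,2)])
  have c0: "0 < \<bar>c\<bar>"
    using c n by (meson less_le_trans of_nat_0_less_iff zero_less_divide_1_iff less_le_trans zero_less_one)
  have r: "\<bar>c * (\<sigma> / 32)\<bar> = \<bar>c\<bar> * (\<sigma> / 32)"
    using \<sigma> by (simp add: abs_mult)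
  show "c * (\<sigma> / 32) \<noteq> 0"
    using c0 \<sigma> by simp
  show "\<bar>c * (\<sigma> / 32)\<bar> \<le> \<sigma> / 32"
    unfolding r using c \<sigma> by (simp add: mult_left_le_one_le)
  show "norm (G (of_real (c * (\<sigma> / 32) * real j / real K))) \<le> e" if "j < K" for j
    using e[OF that] by (simp add: node_def mult_ac)
  have e0: "0 \<le> e"
    using e[OF K] norm_ge_zero order_trans by blast
  have "1 / \<bar>c\<bar> \<le> n"
    using c(1) c0 n by (simp add: field_simps)
  then have "1152 / \<sigma> * (1 / \<bar>c\<bar>) \<le> 1152 / \<sigma> * n"
    using \<sigma> by (intro mult_left_mono) auto
  then have "36 / \<bar>c * (\<sigma> / 32)\<bar> \<le> 1152 * real n / \<sigma>"
    unfolding r by (simp add: mult_ac)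
  then have "(36 / \<bar>c * (\<sigma> / 32)\<bar>) ^ K \<le> (1152 * real n / \<sigma>) ^ K"
    by (intro power_mono) auto
  then have "e * (36 / \<bar>c * (\<sigma> / 32)\<bar>) ^ K \<le> e * Y"
    using e0 Y by (intro mult_left_mono) auto
  then show "e * (36 / \<bar>c * (\<sigma> / 32)\<bar>) ^ K \<le> 1"
    using assms(6) by linarith
qed (use assms in auto)

lemma rectangle_half: "rectangle (\<sigma> / 2) \<subseteq> rectangle \<sigma>"
  using \<sigma> by (intro rectangle_mono) auto

text \<open>On an axis with \<open>\<bar>a i\<bar> \<ge> 1 / n\<close> a quotient is close to
  \<open>a i\<close> times the derivative, so a small quotient bounds the derivative at the cost of
  a factor \<open>n\<close>. It is the derivative that is extrapolated; its smallness on [-1, 1]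
  then gives a Lipschitz bound.\<close>

lemma small_quotients_imp_nearly_constant:
  assumes \<phi>: "\<phi> \<in> analytic_class \<sigma> Q" and a: "norm_n n a = 1"
    and d: "\<And>i j. i < n \<Longrightarrow> j < K \<Longrightarrow>
      norm (of_real (d i j) - of_real (a i) * deriv \<phi> (of_real (a i * node j))) \<le> 4 * Q * T\<^sup>2 / \<sigma>\<^sup>2"
    and small: "\<And>i j. i < n \<Longrightarrow> j < K \<Longrightarrow> \<bar>d i j\<bar> \<le> T"
    and t: "\<bar>t\<bar> \<le> 1"
  shows "\<bar>real_trace \<phi> t - real_trace \<phi> 0\<bar> \<le> \<omega> / 8"
proof -
  obtain i where i: "i < n" "1 / n \<le> \<bar>a i\<bar>"
    using large_component[OF a] by blast
  have ai: "\<bar>a i\<bar> \<le> 1"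
    using abs_component_le[OF i(1), of a] a by simp
  define e where "e = real n * (T + 4 * Q * T\<^sup>2 / \<sigma>\<^sup>2)"
  have deriv_small: "norm (deriv \<phi> (of_real u)) \<le> \<omega> / 8" if u: "\<bar>u\<bar> \<le> 1" for u
  proof (rule extrapolate_along_axis[of "deriv \<phi>" "a i" e, OF _ _ i(2) ai _ _ u])
    show "deriv \<phi> analytic_on rectangle (\<sigma> / 2)"
      using \<phi> rectangle_half by (auto simp: analytic_class_def intro: analytic_deriv analytic_on_subset)
    show "norm (deriv \<phi> z) \<le> 2 * Q / \<sigma>" if "z \<in> rectangle (\<sigma> / 2)" for z
      using norm_higher_deriv_le[OF \<phi> _ cball_half_subset_rectangle[OF that], of 1] \<sigma> by (simp add: mult.commute)
    show "norm (deriv \<phi> (of_real (a i * node j))) \<le> e" if j: "j < K" for j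
    proof -
      let ?D = "deriv \<phi> (of_real (a i * node j))"
      have "\<bar>a i\<bar> * norm ?D = norm (of_real (a i) * ?D)"
        by (simp add: norm_mult)
      also have "\<dots> \<le> norm (complex_of_real (d i j)) + norm (of_real (d i j) - of_real (a i) * ?D)"
        by (metis norm_triangle_sub norm_minus_commute add.commute)
      also have "\<dots> \<le> T + 4 * Q * T\<^sup>2 / \<sigma>\<^sup>2"
        using d[OF i(1) j] small[OF i(1) j] by (intro add_mono) auto
      finally have "1 / n * norm ?D \<le> T + 4 * Q * T\<^sup>2 / \<sigma>\<^sup>2"
        by (rule order_trans[OF mult_right_mono[OF i(2) norm_ge_zero]])
      then show ?thesis
        using n by (simp add: e_def field_simps)
    qed
    show "e * Y \<le> 1"
    proof -
      have "T\<^sup>2 \<le> T * (1 / 1000)"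
        using T T_le mult_left_mono[of T "1 / 1000" T] by (simp add: power2_eq_square)
      then have "4 * Q * T\<^sup>2 / \<sigma>\<^sup>2 \<le> 4 * Q * (T * (1 / 1000)) / \<sigma>\<^sup>2"
        using Q by (intro divide_right_mono mult_left_mono) auto
      also have "\<dots> = T * (Q / \<sigma>\<^sup>2) * (1 / 250)"
        by (simp add: mult.commute)
      also have "\<dots> \<le> T * (Q / \<sigma>\<^sup>2) * 1"
        using T Q by (intro mult_left_mono) auto
      finally have 1: "4 * Q * T\<^sup>2 / \<sigma>\<^sup>2 \<le> T * (Q / \<sigma>\<^sup>2)"
        by simp
      have "1 \<le> Q / \<sigma>\<^sup>2"
        using Q \<sigma> by (simp add: le_divide_eq order_trans[OF power_le_one])
      then have "T * 1 \<le> T * (Q / \<sigma>\<^sup>2)"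
        using T by (intro mult_left_mono) auto
      then have 2: "T \<le> T * (Q / \<sigma>\<^sup>2)"
        by simp
      have "e \<le> real n * (T * (Q / \<sigma>\<^sup>2) + T * (Q / \<sigma>\<^sup>2))"
        unfolding e_def using 1 2 by (intro mult_left_mono add_mono) auto
      then have "e * Y \<le> real n * (T * (Q / \<sigma>\<^sup>2) + T * (Q / \<sigma>\<^sup>2)) * Y"
        using Y by (intro mult_right_mono) auto
      also have "\<dots> = T * (2 * Q ^ 1 * real n ^ 1 / \<sigma> ^ 2 * Y)"
        by (simp add: field_simps)
      also have "\<dots> \<le> 1"
        by (intro T_mult_le monomial_le) auto
      finally show ?thesis .
    qed
  qed
  have "norm (\<phi> (of_real t) - \<phi> (of_real 0)) \<le> \<omega> / 8 * \<bar>t - 0\<bar>"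
    by (rule lipschitz_on_interval[OF \<phi>]) (use \<sigma> t deriv_small in auto)
  also have "\<dots> \<le> \<omega> / 8"
    using t \<omega> by (simp add: mult_left_le)
  finally show ?thesis
    using abs_Re_le_cmod[of "\<phi> (of_real t) - \<phi> (of_real 0)"] by (simp add: real_trace_def)
qed

text \<open>With \<open>u\<close>, \<open>v\<close> the two scalar products, the difference splits
  into \<phi> - \<phi>' at \<open>u\<close>, extrapolated to at most \<omega> / 8, and the increment
  of \<phi>' from \<open>u\<close> to \<open>v\<close>, at most \<omega> / 2 by Lipschitz
  continuity. The samples compare the profiles at different arguments \<open>a i * node j\<close>
  and \<open>a' i * node j\<close>; that shift is again paid by Lipschitz continuity of
  \<phi>'.\<close>

lemma close_directions_imp_close:
  assumes \<phi>: "\<phi> \<in> analytic_class \<sigma> Q" "\<phi>' \<in> analytic_class \<sigma> Q"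
    and a: "norm_n n a = 1" "norm_n n a' = 1"
    and aa': "\<And>k. k < n \<Longrightarrow> \<bar>a k - a' k\<bar> \<le> 32 * Q * real n * T / \<sigma>\<^sup>2"
    and y: "\<And>i j. i < n \<Longrightarrow> j < K \<Longrightarrow> \<bar>real_trace \<phi> (a i * node j) - real_trace \<phi>' (a' i * node j)\<bar> \<le> 2 * Q * T ^ 4"
    and x: "norm_n n x \<le> 1"
  shows "\<bar>real_trace \<phi> (scalar_prod_n n a x) - real_trace \<phi>' (scalar_prod_n n a' x)\<bar> \<le> \<omega>"
proof -
  obtain i where i: "i < n" "1 / n \<le> \<bar>a i\<bar>"
    using large_component[OF a(1)] by blast
  have ai: "\<bar>a i\<bar> \<le> 1" "\<bar>a' i\<bar> \<le> 1"
    using abs_component_le[OF i(1), of a] abs_component_le[OF i(1), of a'] a by auto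
  have Q0: "0 \<le> Q / \<sigma>"
    using Q \<sigma> by simp
  define \<alpha> where "\<alpha> = 32 * Q * real n * T / \<sigma>\<^sup>2"
  have \<alpha>0: "0 \<le> \<alpha>"
    using Q T by (simp add: \<alpha>_def)
  have lipschitz: "\<bar>real_trace \<phi>' u - real_trace \<phi>' v\<bar> \<le> Q / \<sigma> * \<bar>u - v\<bar>" if "\<bar>u\<bar> \<le> 1" "\<bar>v\<bar> \<le> 1" for u v
  proof -
    have "norm (\<phi>' (of_real u) - \<phi>' (of_real v)) \<le> Q / \<sigma> * \<bar>u - v\<bar>"
      by (rule lipschitz_on_interval[OF \<phi>(2)]) (use \<sigma> that norm_deriv_le[OF \<phi>(2)] in auto)
    then show ?thesis
      using abs_Re_le_cmod[of "\<phi>' (of_real u) - \<phi>' (of_real v)"] by (simp add: real_trace_def)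
  qed
  define e where "e = 2 * Q * T ^ 4 + Q / \<sigma> * \<alpha>"
  define G where "G = (\<lambda>z. \<phi> z - \<phi>' z)"
  have G_real: "norm (G (of_real u)) = \<bar>real_trace \<phi> u - real_trace \<phi>' u\<bar>" if "\<bar>u\<bar> \<le> 1" for u
  proof -
    have "G (of_real u) = of_real (real_trace \<phi> u - real_trace \<phi>' u)"
      using of_real_real_trace[OF \<phi>(1) _ that] of_real_real_trace[OF \<phi>(2) _ that] \<sigma>
      by (simp add: G_def)
    then show ?thesis
      by (simp only: norm_of_real)
  qed
  have G_small: "norm (G (of_real u)) \<le> \<omega> / 8" if u: "\<bar>u\<bar> \<le> 1" for u
  proof (rule extrapolate_along_axis[of G "a i" e, OF _ _ i(2) ai(1) _ _ u])
    show "G analytic_on rectangle (\<sigma> / 2)"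
      unfolding G_def using \<phi> rectangle_half
      by (intro analytic_on_diff) (auto simp: analytic_class_def intro: analytic_on_subset)
    show "norm (G z) \<le> 2 * Q / \<sigma>" if "z \<in> rectangle (\<sigma> / 2)" for z
    proof -
      have "z \<in> rectangle \<sigma>"
        using that rectangle_half by blast
      then have "norm (\<phi> z) \<le> Q" "norm (\<phi>' z) \<le> Q"
        using \<phi> by (auto simp: analytic_class_def)
      then have "norm (G z) \<le> 2 * Q"
        unfolding G_def using norm_triangle_ineq4[of "\<phi> z" "\<phi>' z"] by linarith
      also have "\<dots> \<le> 2 * Q / \<sigma>"
        using \<sigma> Q by (simp add: le_divide_eq mult_left_le)
      finally show ?thesis .
    qed
    show "norm (G (of_real (a i * node j))) \<le> e" if j: "j < K" for j
    proof -
      have u: "\<bar>a i * node j\<bar> \<le> 1" and v: "\<bar>a' i * node j\<bar> \<le> 1"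
        using abs_mult_node_le[OF ai(1) j] abs_mult_node_le[OF ai(2) j] by auto
      have "\<bar>a' i * node j - a i * node j\<bar> = \<bar>a i - a' i\<bar> * node j"
        using node_bounds[OF j] by (simp add: abs_mult abs_minus_commute flip: left_diff_distrib)
      also have "\<dots> \<le> \<alpha> * 1"
        using aa'[OF i(1)] node_bounds[OF j] \<alpha>0 \<sigma> unfolding \<alpha>_def by (intro mult_mono) auto
      finally have "Q / \<sigma> * \<bar>a' i * node j - a i * node j\<bar> \<le> Q / \<sigma> * \<alpha>"
        using Q0 by (intro mult_left_mono) auto
      then show ?thesis
        unfolding G_real[OF u] e_def using y[OF i(1) j] lipschitz[OF v u] by linarith
    qed
    show "e * Y \<le> 1"
    proof -
      have "T ^ 4 \<le> T ^ 1"
        using T T_le by (intro power_decreasing) auto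
      then have "2 * Q * T ^ 4 \<le> 2 * Q * T * 1"
        using Q by simp
      also have "\<dots> \<le> 2 * Q * T * (Q * real n / \<sigma> ^ 3)"
      proof (intro mult_left_mono)
        have "1 * 1 \<le> Q * real n"
          using Q n by (intro mult_mono) auto
        then show "1 \<le> Q * real n / \<sigma> ^ 3"
          using \<sigma> power_le_one[of \<sigma> 3] by (simp add: le_divide_eq)
      qed (use Q T in auto)
      finally have "e \<le> 2 * Q * T * (Q * real n / \<sigma> ^ 3) + Q / \<sigma> * \<alpha>"
        by (simp add: e_def)
      \<comment> \<open>34 = 2 + 32: the sample errors and the shift of the arguments.\<close>
      also have "\<dots> = T * (34 * Q ^ 2 * real n ^ 1 / \<sigma> ^ 3)"
        using \<sigma> by (simp add: \<alpha>_def power2_eq_square power3_eq_cube field_simps)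
      finally have "e * Y \<le> T * (34 * Q ^ 2 * real n ^ 1 / \<sigma> ^ 3) * Y"
        using Y by (intro mult_right_mono) auto
      also have "\<dots> = T * (34 * Q ^ 2 * real n ^ 1 / \<sigma> ^ 3 * Y)"
        by simp
      also have "\<dots> \<le> 1"
        by (intro T_mult_le monomial_le) auto
      finally show ?thesis .
    qed
  qed
  let ?u = "scalar_prod_n n a x" and ?v = "scalar_prod_n n a' x"
  have u: "\<bar>?u\<bar> \<le> 1" and v: "\<bar>?v\<bar> \<le> 1"
    using abs_scalar_prod_unit_le a x by auto
  have "?u - ?v = scalar_prod_n n (\<lambda>k. a k - a' k) x"
    by (simp add: scalar_prod_n_def sum_subtractf left_diff_distrib)
  then have "\<bar>?u - ?v\<bar> \<le> n * \<alpha>"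
    using abs_scalar_prod_le[of n "\<lambda>k. a k - a' k" \<alpha> x] aa' x by (simp add: \<alpha>_def)
  then have "Q / \<sigma> * \<bar>?u - ?v\<bar> \<le> Q / \<sigma> * (n * \<alpha>)"
    using Q0 by (intro mult_left_mono) auto
  also have "\<dots> \<le> \<omega> / 2"
  proof -
    have "\<omega> / 2 * (T * (64 * Q ^ 2 * real n ^ 2 / \<sigma> ^ 3 / \<omega>)) \<le> \<omega> / 2 * 1"
      using \<omega> by (intro mult_left_mono T_mult_le monomial_le) auto
    moreover have "Q / \<sigma> * (n * \<alpha>) = \<omega> / 2 * (T * (64 * Q ^ 2 * real n ^ 2 / \<sigma> ^ 3 / \<omega>))"
      using \<sigma> \<omega> by (simp add: \<alpha>_def power2_eq_square power3_eq_cube field_simps)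
    ultimately show ?thesis
      by linarith
  qed
  finally have "\<bar>real_trace \<phi>' ?u - real_trace \<phi>' ?v\<bar> \<le> \<omega> / 2"
    using lipschitz[OF u v] by linarith
  then show ?thesis
    using G_small[OF u] \<omega> unfolding G_real[OF u] by linarith
qed

section \<open>Functions that admit the same answers\<close>

definition coarse_data :: "(complex \<Rightarrow> complex) \<Rightarrow> (nat \<Rightarrow> real) \<Rightarrow> (nat \<Rightarrow> nat \<Rightarrow> real) \<Rightarrow> (nat \<Rightarrow> nat \<Rightarrow> real) \<Rightarrow> bool" where
  "coarse_data \<phi> a y y' \<longleftrightarrow> (\<forall>i<n. \<forall>j<K.
     \<bar>y i j - real_trace \<phi> (a i * node j)\<bar> \<le> Q * T ^ 4 \<and>
     \<bar>y' i j - real_trace \<phi> (a i * node j + T\<^sup>2 * a i)\<bar> \<le> Q * T ^ 4)"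

text \<open>The unshifted value at the node is already among the coarse data, so a gradient costs
  only \<open>n\<close> further evaluations.\<close>

definition gradient_data :: "(complex \<Rightarrow> complex) \<Rightarrow> (nat \<Rightarrow> real) \<Rightarrow> nat \<Rightarrow> nat \<Rightarrow> (nat \<Rightarrow> real) \<Rightarrow> bool" where
  "gradient_data \<phi> a i j z \<longleftrightarrow> (\<forall>k<n. \<bar>z k - real_trace \<phi> (a i * node j + T\<^sup>2 * a k)\<bar> \<le> Q * T ^ 4)"

lemma coarse_dataD:
  assumes "coarse_data \<phi> a y y'" and "i < n" and "j < K"
  shows "\<bar>y i j - real_trace \<phi> (a i * node j)\<bar> \<le> Q * T ^ 4"
    and "\<bar>y' i j - real_trace \<phi> (a i * node j + T\<^sup>2 * a i)\<bar> \<le> Q * T ^ 4"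
  using assms by (auto simp: coarse_data_def)

lemma gradient_dataD:
  "gradient_data \<phi> a i j z \<Longrightarrow> k < n \<Longrightarrow> \<bar>z k - real_trace \<phi> (a i * node j + T\<^sup>2 * a k)\<bar> \<le> Q * T ^ 4"
  by (simp add: gradient_data_def)

lemma T_squared_le: "T\<^sup>2 \<le> 1 / 1000"
  using T T_le mult_mono[of T 1 T "1 / 1000"] by (simp add: power2_eq_square)

lemma abs_node_shift_le:
  assumes "norm_n n a = 1" and "i < n" and "k < n" and "j < K"
  shows "\<bar>a i * node j\<bar> \<le> 1" "\<bar>a i * node j + T\<^sup>2 * a k\<bar> \<le> 1"
proof -
  have c: "\<bar>a i\<bar> \<le> 1" "\<bar>a k\<bar> \<le> 1"
    using abs_component_le[OF assms(2), of a] abs_component_le[OF assms(3), of a] assms(1) by auto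
  have "\<bar>a i * node j\<bar> \<le> 1 / 32"
    using abs_mult_node_le[OF c(1) assms(4)] .
  moreover have "\<bar>T\<^sup>2 * a k\<bar> \<le> 1 / 1000 * 1"
    unfolding abs_mult using T_squared_le c by (intro mult_mono) auto
  ultimately show "\<bar>a i * node j\<bar> \<le> 1" "\<bar>a i * node j + T\<^sup>2 * a k\<bar> \<le> 1"
    by auto
qed

lemma quotient_close:
  assumes "\<phi> \<in> analytic_class \<sigma> Q" and "norm_n n a = 1" and "i < n" and "k < n" and "j < K"
    and "\<bar>y - real_trace \<phi> (a i * node j)\<bar> \<le> Q * T ^ 4"
    and "\<bar>y' - real_trace \<phi> (a i * node j + T\<^sup>2 * a k)\<bar> \<le> Q * T ^ 4"
  shows "norm (of_real ((y' - y) / T\<^sup>2) - of_real (a k) * deriv \<phi> (of_real (a i * node j))) \<le> 4 * Q * T\<^sup>2 / \<sigma>\<^sup>2"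
proof (rule difference_quotient_close[OF assms(1) \<sigma>])
  show "\<bar>a k\<bar> \<le> 1"
    using abs_component_le[OF assms(4), of a] assms(2) by simp
qed (use assms abs_node_shift_le[OF assms(2-5)] Q T in auto)

text \<open>The node \<open>i0\<close>, \<open>j0\<close> is read off the answers and is therefore
  common to both functions; \<open>pick\<close> promises it only when some quotient is
  large.\<close>

lemma answers_determine_function:
  assumes \<phi>: "\<phi> \<in> analytic_class \<sigma> Q" "\<phi>' \<in> analytic_class \<sigma> Q"
    and a: "norm_n n a = 1" "norm_n n a' = 1"
    and coarse: "coarse_data \<phi> a y y'" "coarse_data \<phi>' a' y y'"
    and pick: "\<And>i j. i < n \<Longrightarrow> j < K \<Longrightarrow> T < \<bar>(y' i j - y i j) / T\<^sup>2\<bar> \<Longrightarrow>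
      i0 < n \<and> j0 < K \<and> T < \<bar>(y' i0 j0 - y i0 j0) / T\<^sup>2\<bar> \<and> gradient_data \<phi> a i0 j0 z \<and> gradient_data \<phi>' a' i0 j0 z"
    and x: "norm_n n x \<le> 1"
  shows "\<bar>real_trace \<phi> (scalar_prod_n n a x) - real_trace \<phi>' (scalar_prod_n n a' x)\<bar> \<le> \<omega>"
proof (cases "\<exists>i j. i < n \<and> j < K \<and> T < \<bar>(y' i j - y i j) / T\<^sup>2\<bar>")
  case False
  \<comment> \<open>Since \<open>node 0 = 0\<close>, the number \<open>y 0 0\<close> is an answer at
    the origin; both functions are nearly constant and stay near this common value.\<close>
  have near0: "\<bar>real_trace \<psi> (scalar_prod_n n b x) - y 0 0\<bar> \<le> \<omega> / 4"
    if \<psi>: "\<psi> \<in> analytic_class \<sigma> Q" and b: "norm_n n b = 1" and data: "coarse_data \<psi> b y y'" for \<psi> b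
  proof -
    have "\<bar>real_trace \<psi> (scalar_prod_n n b x) - real_trace \<psi> 0\<bar> \<le> \<omega> / 8"
    proof (rule small_quotients_imp_nearly_constant[OF \<psi> b, where d = "\<lambda>i j. (y' i j - y i j) / T\<^sup>2"])
      show "\<bar>scalar_prod_n n b x\<bar> \<le> 1"
        by (rule abs_scalar_prod_unit_le[OF b x])
      show "\<bar>(y' i j - y i j) / T\<^sup>2\<bar> \<le> T" if "i < n" "j < K" for i j
        using False that by force
      show "norm (of_real ((y' i j - y i j) / T\<^sup>2) - of_real (b i) * deriv \<psi> (of_real (b i * node j)))
          \<le> 4 * Q * T\<^sup>2 / \<sigma>\<^sup>2" if "i < n" "j < K" for i j
        by (rule quotient_close[OF \<psi> b that(1,1,2) coarse_dataD[OF data that]])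
    qed
    moreover have "\<bar>y 0 0 - real_trace \<psi> 0\<bar> \<le> Q * T ^ 4"
      using coarse_dataD(1)[OF data _ K, of 0] n by (simp add: node_def)
    moreover have "Q * T ^ 4 \<le> \<omega> / 8"
    proof -
      have "T ^ 4 \<le> T ^ 1"
        using T T_le by (intro power_decreasing) auto
      then have "Q * T ^ 4 \<le> Q * T"
        using Q by simp
      also have "\<dots> = \<omega> / 8 * (T * (8 * Q ^ 1 * real n ^ 0 / \<sigma> ^ 0 / \<omega>))"
        using \<omega> by simp
      also have "\<dots> \<le> \<omega> / 8 * 1"
        using \<omega> by (intro mult_left_mono T_mult_le monomial_le) auto
      finally show ?thesis by simp
    qed
    ultimately show ?thesis
      by linarith
  qed
  show ?thesis
    using near0[OF \<phi>(1) a(1) coarse(1)] near0[OF \<phi>(2) a(2) coarse(2)] \<omega> by linarith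
next
  case True
  then have i0: "i0 < n" and j0: "j0 < K" and big: "T < \<bar>(y' i0 j0 - y i0 j0) / T\<^sup>2\<bar>"
    and grad: "gradient_data \<phi> a i0 j0 z" "gradient_data \<phi>' a' i0 j0 z"
    using pick by blast+
  define \<mu> where "\<mu> = Re (deriv \<phi> (of_real (a i0 * node j0)))"
  define \<nu> where "\<nu> = Re (deriv \<phi>' (of_real (a' i0 * node j0)))"
  define \<eta> where "\<eta> = 4 * Q * T\<^sup>2 / \<sigma>\<^sup>2"
  have real_part: "\<bar>d - c * Re w\<bar> \<le> norm (of_real d - of_real c * w)" for d c w
    using abs_Re_le_cmod[of "of_real d - of_real c * w"] by simp
  have g: "\<bar>(z k - y i0 j0) / T\<^sup>2 - \<mu> * a k\<bar> \<le> \<eta>" if "k < n" for k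
    unfolding \<mu>_def \<eta>_def mult.commute[of _ "a k"]
    by (rule order_trans[OF real_part quotient_close[OF \<phi>(1) a(1) i0 that j0
        coarse_dataD(1)[OF coarse(1) i0 j0] gradient_dataD[OF grad(1) that]]])
  have g': "\<bar>(z k - y i0 j0) / T\<^sup>2 - \<nu> * a' k\<bar> \<le> \<eta>" if "k < n" for k
    unfolding \<nu>_def \<eta>_def mult.commute[of _ "a' k"]
    by (rule order_trans[OF real_part quotient_close[OF \<phi>(2) a(2) i0 that j0
        coarse_dataD(1)[OF coarse(2) i0 j0] gradient_dataD[OF grad(2) that]]])
  \<comment> \<open>The quotient exceeds \<open>T\<close> and equals \<open>a i0 * \<mu>\<close> up
    to \<eta> \<le> T / 2; as \<bar>a i0\<bar> \<le> 1, the derivative itself is at least T /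
    2.\<close>
  have mu_large: "T / 2 \<le> \<bar>\<mu>\<bar>"
  proof -
    have "\<bar>(y' i0 j0 - y i0 j0) / T\<^sup>2 - a i0 * \<mu>\<bar> \<le> \<eta>"
      unfolding \<mu>_def \<eta>_def
      by (rule order_trans[OF real_part quotient_close[OF \<phi>(1) a(1) i0 i0 j0 coarse_dataD[OF coarse(1) i0 j0]]])
    moreover have "\<eta> \<le> T / 2"
    proof -
      have "\<eta> = T / 2 * (T * (8 * Q ^ 1 * real n ^ 0 / \<sigma> ^ 2 * 1))"
        by (simp add: \<eta>_def power2_eq_square)
      also have "\<dots> \<le> T / 2 * (T * (8 * Q ^ 1 * real n ^ 0 / \<sigma> ^ 2 * Y))"
        using T Q Y by (intro mult_left_mono) auto
      also have "\<dots> \<le> T / 2 * 1"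
        using T by (intro mult_left_mono T_mult_le monomial_le) auto
      finally show ?thesis by simp
    qed
    moreover have "\<bar>a i0 * \<mu>\<bar> \<le> \<bar>\<mu>\<bar>"
      using abs_component_le[OF i0, of a] a(1) by (simp add: abs_mult mult_left_le_one_le)
    ultimately show ?thesis
      using big by linarith
  qed
  obtain s :: real where s: "s = 1 \<or> s = -1"
    and close: "\<And>k. k < n \<Longrightarrow> \<bar>a k - s * a' k\<bar> \<le> 4 * \<eta> * n / (T / 2)"
  proof (rule proportional_unit_vectors_close[OF a _ _ mu_large g g'])
    show "0 < n" "0 < T / 2"
      using n T by auto
  qed auto
  \<comment> \<open>\<eta> is of order T ^ 2 and is divided by T / 2, which leaves an error of order
    \<open>T\<close> in the direction; 32 = 4 * 4 * 2.\<close>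
  have \<alpha>: "4 * \<eta> * n / (T / 2) = 32 * Q * real n * T / \<sigma>\<^sup>2"
    using T by (simp add: \<eta>_def power2_eq_square)
  have samples: "\<bar>real_trace \<phi> (a i * node j) - real_trace \<phi>' (a' i * node j)\<bar> \<le> 2 * Q * T ^ 4"
    if "i < n" "j < K" for i j
  proof -
    show ?thesis
      using coarse_dataD(1)[OF coarse(1) that] coarse_dataD(1)[OF coarse(2) that] by linarith
  qed
  show ?thesis
  proof (cases "s = 1")
    case True
    show ?thesis
      by (rule close_directions_imp_close[OF \<phi> a _ samples x]) (use close \<alpha> True in auto)
  next
    case False
    then have s: "s = -1"
      using s by simp
    have trace: "real_trace (\<lambda>z. \<phi>' (- z)) t = real_trace \<phi>' (- t)" for t
      by (simp add: real_trace_def)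
    have "\<bar>real_trace \<phi> (scalar_prod_n n a x) - real_trace (\<lambda>z. \<phi>' (- z)) (scalar_prod_n n (\<lambda>k. - a' k) x)\<bar> \<le> \<omega>"
    proof (rule close_directions_imp_close[OF \<phi>(1) analytic_class_reflect[OF \<phi>(2)] a(1) _ _ _ x])
      show "norm_n n (\<lambda>k. - a' k) = 1"
        using a(2) by (simp add: norm_n_def L2_set_def)
      show "\<bar>a k - - a' k\<bar> \<le> 32 * Q * real n * T / \<sigma>\<^sup>2" if "k < n" for k
        using close[OF that] s \<alpha> by simp
      show "\<bar>real_trace \<phi> (a i * node j) - real_trace (\<lambda>z. \<phi>' (- z)) (- a' i * node j)\<bar> \<le> 2 * Q * T ^ 4"
        if "i < n" "j < K" for i j
        using samples[OF that] by (simp add: trace)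
    qed
    then show ?thesis
      by (simp add: trace scalar_prod_n_def sum_negf)
  qed
qed

section \<open>Queries and what their answers mean\<close>

text \<open>The index \<open>m < n * K\<close> encodes the node \<open>m mod K\<close> on the axis \<open>m div K\<close>.\<close>

definition point :: "nat \<Rightarrow> nat \<Rightarrow> real \<Rightarrow> nat \<Rightarrow> real" where
  "point m k c = (\<lambda>l. (if l = m div K then node (m mod K) else 0) + (if l = k then c else 0))"

definition quotient :: "real list \<Rightarrow> nat \<Rightarrow> real" where
  "quotient ys m = (ys ! (n * K + m) - ys ! m) / T\<^sup>2"

text \<open>If no quotient is large, \<open>chosen\<close> is an arbitrary index; \<open>raw_query\<close> may then leave the ball, whence the test in \<open>query\<close>.\<close>

definition chosen :: "real list \<Rightarrow> nat" where
  "chosen ys = (SOME m. m < n * K \<and> T < \<bar>quotient ys m\<bar>)"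

text \<open>The number of answers so far tells which evaluation is due; their values matter only in
  the last block, where the algorithm is adaptive. In the first block the shift is 0 and the axis
  index 0 a placeholder.\<close>

definition raw_query :: "real list \<Rightarrow> nat \<Rightarrow> real" where
  "raw_query ys = (let m = length ys in
     if m < n * K then point m 0 0
     else if m < 2 * (n * K) then point (m - n * K) ((m - n * K) div K) (T\<^sup>2)
     else point (chosen ys) (m - 2 * (n * K)) (T\<^sup>2))"

text \<open>After \<open>2 * (n * K) + n\<close> answers the shift would affect a coordinate of
  index at least \<open>n\<close>; such a point also lies outside the ball and becomes the origin.
  This pads the algorithm to any larger number of evaluations.\<close>

definition query :: "real list \<Rightarrow> nat \<Rightarrow> real" where
  "query ys = (if raw_query ys \<in> unit_ball_n n then raw_query ys else (\<lambda>_. 0))"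

lemma query_in_unit_ball: "query ys \<in> unit_ball_n n"
  by (auto simp: query_def unit_ball_n_def topspace_Euclidean_space norm_n_def L2_set_def)

lemma point_in_unit_ball:
  assumes "m < n * K" and "k < n" and "0 \<le> c" and "c \<le> 1 / 2"
  shows "point m k c \<in> unit_ball_n n"
proof -
  have md: "m div K < n" "m mod K < K"
    using assms K by (auto intro: less_mult_imp_div_less)
  have node: "0 \<le> node (m mod K)" "node (m mod K) \<le> 1 / 2"
    using node_bounds[OF md(2)] \<sigma> by auto
  have "norm_n n (point m k c) \<le> (\<Sum>l<n. \<bar>point m k c l\<bar>)"
    unfolding norm_n_def by (rule L2_set_le_sum_abs)
  also have "\<dots> = (\<Sum>l<n. (if l = m div K then node (m mod K) else 0) + (if l = k then c else 0))"
    using node assms by (intro sum.cong) (auto simp: point_def)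
  also have "\<dots> = node (m mod K) + c"
    using md assms by (simp add: sum.distrib)
  finally have "norm_n n (point m k c) \<le> 1"
    using node assms by linarith
  then show ?thesis
    using md assms by (auto simp: unit_ball_n_def topspace_Euclidean_space point_def)
qed

lemma scalar_prod_point:
  assumes "m < n * K" and "k < n"
  shows "scalar_prod_n n a (point m k c) = a (m div K) * node (m mod K) + c * a k"
proof -
  have md: "m div K < n"
    using assms by (auto intro: less_mult_imp_div_less)
  have "scalar_prod_n n a (point m k c)
      = (\<Sum>l<n. (if l = m div K then a l * node (m mod K) else 0) + (if l = k then c * a l else 0))"
    unfolding scalar_prod_n_def point_def by (intro sum.cong) (auto simp: algebra_simps)
  also have "\<dots> = a (m div K) * node (m mod K) + c * a k"
    using md assms by (simp add: sum.distrib)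
  finally show ?thesis .
qed

text \<open>Only the first two blocks of answers enter the choice, so all queries of the last block
  use the same node, and it can be read off the complete list.\<close>

lemma chosen_take:
  assumes "2 * (n * K) \<le> i"
  shows "chosen (take i ys) = chosen ys"
proof -
  have "quotient (take i ys) m = quotient ys m" if "m < n * K" for m
    using that assms by (simp add: quotient_def)
  then have "(\<lambda>m. m < n * K \<and> T < \<bar>quotient (take i ys) m\<bar>) = (\<lambda>m. m < n * K \<and> T < \<bar>quotient ys m\<bar>)"
    by auto
  then show ?thesis
    by (simp add: chosen_def)
qed

context
  fixes \<phi> :: "complex \<Rightarrow> complex" and a :: "nat \<Rightarrow> real" and f :: "(nat \<Rightarrow> real) \<Rightarrow> real" and ys :: "real list"
  assumes f: "\<And>x. x \<in> unit_ball_n n \<Longrightarrow> f x = real_trace \<phi> (scalar_prod_n n a x)"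
    and ys: "admissible_answers (Q * T ^ 4) f query ys"
    and len: "2 * (n * K) + n \<le> length ys"
begin

lemma answer_close:
  assumes "i < 2 * (n * K) + n" and "raw_query (take i ys) = point m k c"
    and "m < n * K" and "k < n" and "0 \<le> c" and "c \<le> 1 / 2"
  shows "\<bar>ys ! i - real_trace \<phi> (a (m div K) * node (m mod K) + c * a k)\<bar> \<le> Q * T ^ 4"
proof -
  have "query (take i ys) = point m k c"
    using assms point_in_unit_ball by (simp add: query_def)
  then have "f (query (take i ys)) = real_trace \<phi> (a (m div K) * node (m mod K) + c * a k)"
    using f point_in_unit_ball[OF assms(3-6)] scalar_prod_point[OF assms(3,4), of a c] by simp
  moreover have "\<bar>ys ! i - f (query (take i ys))\<bar> \<le> Q * T ^ 4"
    using ys assms(1) len unfolding admissible_answers_def by simp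
  ultimately show ?thesis
    by simp
qed

lemma coarse_data_answers:
  "coarse_data \<phi> a (\<lambda>i j. ys ! (i * K + j)) (\<lambda>i j. ys ! (n * K + (i * K + j)))"
  unfolding coarse_data_def
proof (intro allI impI)
  fix i j assume ij: "i < n" "j < K"
  have m: "i * K + j < n * K"
    using ij by (rule flat_index_less)
  have dm: "(i * K + j) div K = i" "(i * K + j) mod K = j"
    using ij by auto
  have len': "length (take (i * K + j) ys) = i * K + j"
    "length (take (n * K + (i * K + j)) ys) = n * K + (i * K + j)"
    using m len by auto
  \<comment> \<open>The summand \<open>0 * a 0\<close> brings an unshifted evaluation into the form
    of \<open>answer_close\<close>.\<close>
  have "\<bar>ys ! (i * K + j) - real_trace \<phi> (a ((i * K + j) div K) * node ((i * K + j) mod K) + 0 * a 0)\<bar> \<le> Q * T ^ 4"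
    by (rule answer_close) (use m n len' in \<open>auto simp: raw_query_def Let_def\<close>)
  moreover have "\<bar>ys ! (n * K + (i * K + j)) - real_trace \<phi> (a ((i * K + j) div K) * node ((i * K + j) mod K) + T\<^sup>2 * a i)\<bar> \<le> Q * T ^ 4"
  proof (rule answer_close)
    show "raw_query (take (n * K + (i * K + j)) ys) = point (i * K + j) i (T\<^sup>2)"
    proof -
      have "\<not> n * K + (i * K + j) < n * K" "n * K + (i * K + j) < 2 * (n * K)"
        "n * K + (i * K + j) - n * K = i * K + j"
        using m by linarith+
      then show ?thesis
        unfolding raw_query_def Let_def len' by (simp only: dm if_False if_True)
    qed
    show "n * K + (i * K + j) < 2 * (n * K) + n"
      using m by linarith
  qed (use m ij T_squared_le in auto)
  ultimately show "\<bar>ys ! (i * K + j) - real_trace \<phi> (a i * node j)\<bar> \<le> Q * T ^ 4 \<and>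
      \<bar>ys ! (n * K + (i * K + j)) - real_trace \<phi> (a i * node j + T\<^sup>2 * a i)\<bar> \<le> Q * T ^ 4"
    unfolding dm by simp
qed

lemma gradient_data_answers:
  assumes "chosen ys < n * K"
  shows "gradient_data \<phi> a (chosen ys div K) (chosen ys mod K) (\<lambda>k. ys ! (2 * (n * K) + k))"
  unfolding gradient_data_def
proof (intro allI impI)
  fix k assume k: "k < n"
  have len': "length (take (2 * (n * K) + k) ys) = 2 * (n * K) + k"
    using k len by auto
  show "\<bar>ys ! (2 * (n * K) + k) - real_trace \<phi> (a (chosen ys div K) * node (chosen ys mod K) + T\<^sup>2 * a k)\<bar> \<le> Q * T ^ 4"
  proof (rule answer_close)
    show "raw_query (take (2 * (n * K) + k) ys) = point (chosen ys) k (T\<^sup>2)"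
      unfolding raw_query_def Let_def len' by (simp add: chosen_take)
  qed (use k assms T_squared_le in auto)
qed

end

text \<open>\<open>query\<close> and \<open>chosen\<close> depend on the answers alone: two
  functions that admit the same list are evaluated at the same points and have their gradients
  measured at the same node.\<close>

lemma admissible_imp_close:
  assumes ridge: "f \<in> ridge_class (real_trace ` analytic_class \<sigma> Q) n" "f' \<in> ridge_class (real_trace ` analytic_class \<sigma> Q) n"
    and ys: "admissible_answers (Q * T ^ 4) f query ys" "admissible_answers (Q * T ^ 4) f' query ys"
    and len: "2 * (n * K) + n \<le> length ys" and x: "x \<in> unit_ball_n n"
  shows "\<bar>f x - f' x\<bar> \<le> \<omega>"
proof -
  obtain a \<phi> where a: "norm_n n a = 1" and \<phi>: "\<phi> \<in> analytic_class \<sigma> Q"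
    and f: "\<And>x. x \<in> unit_ball_n n \<Longrightarrow> f x = real_trace \<phi> (scalar_prod_n n a x)"
    using ridge(1) by (auto simp: ridge_class_def)
  obtain a' \<phi>' where a': "norm_n n a' = 1" and \<phi>': "\<phi>' \<in> analytic_class \<sigma> Q"
    and f': "\<And>x. x \<in> unit_ball_n n \<Longrightarrow> f' x = real_trace \<phi>' (scalar_prod_n n a' x)"
    using ridge(2) by (auto simp: ridge_class_def)
  have "\<bar>real_trace \<phi> (scalar_prod_n n a x) - real_trace \<phi>' (scalar_prod_n n a' x)\<bar> \<le> \<omega>"
  proof (rule answers_determine_function[OF \<phi> \<phi>' a a'
        coarse_data_answers[OF f ys(1) len] coarse_data_answers[OF f' ys(2) len]])
    fix i j
    assume ij: "i < n" "j < K"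
      and "T < \<bar>(ys ! (n * K + (i * K + j)) - ys ! (i * K + j)) / T\<^sup>2\<bar>"
    then have "i * K + j < n * K \<and> T < \<bar>quotient ys (i * K + j)\<bar>"
      using flat_index_less[OF ij] by (simp add: quotient_def)
    then have chosen: "chosen ys < n * K \<and> T < \<bar>quotient ys (chosen ys)\<bar>"
      unfolding chosen_def by (rule someI)
    then have "chosen ys div K < n" "chosen ys mod K < K"
      using K by (auto intro: less_mult_imp_div_less)
    moreover have "chosen ys div K * K + chosen ys mod K = chosen ys"
      by simp
    ultimately show "chosen ys div K < n \<and> chosen ys mod K < K \<and>
        T < \<bar>(ys ! (n * K + (chosen ys div K * K + chosen ys mod K)) - ys ! (chosen ys div K * K + chosen ys mod K)) / T\<^sup>2\<bar> \<and>
        gradient_data \<phi> a (chosen ys div K) (chosen ys mod K) (\<lambda>k. ys ! (2 * (n * K) + k)) \<and>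
        gradient_data \<phi>' a' (chosen ys div K) (chosen ys mod K) (\<lambda>k. ys ! (2 * (n * K) + k))"
      using chosen gradient_data_answers[OF f ys(1) len] gradient_data_answers[OF f' ys(2) len]
      by (simp only: quotient_def)
  next
    show "norm_n n x \<le> 1"
      using x by (simp add: unit_ball_n_def)
  qed
  then show ?thesis
    using f f' x by simp
qed

end

section \<open>The algorithm and the choice of constants\<close>

lemma exists_recovery_algorithm:
  assumes "recovery \<sigma> Q \<omega> T Y n K" and "2 * (n * K) + n \<le> N" and "0 \<le> \<delta>"
  shows "\<exists>(M :: (nat \<Rightarrow> real) measure) query approx.
       prob_adaptive_algorithm n M query approx \<and>
       (\<forall>f \<in> ridge_class (real_trace ` analytic_class \<sigma> Q) n.
          \<P>(w in M. \<forall>ys. length ys = N \<and> admissible_answers (Q * T ^ 4) f (query w) ys \<longrightarrow>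
                 (\<forall>x \<in> unit_ball_n n. \<bar>approx w ys x - f x\<bar> \<le> \<omega>)) \<ge> 1 - \<delta>)"
proof -
  interpret recovery \<sigma> Q \<omega> T Y n K
    by fact
  define F where "F = ridge_class (real_trace ` analytic_class \<sigma> Q) n"
  \<comment> \<open>For admissible answers \<open>f\<close> itself witnesses that the choice
    succeeds; for other lists the output is arbitrary.\<close>
  define approx where "approx ys = (SOME f. f \<in> F \<and> admissible_answers (Q * T ^ 4) f query ys)" for ys
  \<comment> \<open>A point mass: the success event is the whole space and has probability
    1.\<close>
  define M :: "(nat \<Rightarrow> real) measure" where "M = measure_pmf (return_pmf (\<lambda>_. 0))"
  have "prob_adaptive_algorithm n M (\<lambda>_. query) (\<lambda>_. approx)"
    unfolding prob_adaptive_algorithm_def M_def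
    using query_in_unit_ball by (auto intro: measure_pmf.prob_space_axioms)
  moreover have "\<P>(w in M. \<forall>ys. length ys = N \<and> admissible_answers (Q * T ^ 4) f query ys \<longrightarrow>
                 (\<forall>x \<in> unit_ball_n n. \<bar>approx ys x - f x\<bar> \<le> \<omega>)) \<ge> 1 - \<delta>" if f: "f \<in> F" for f
  proof -
    have "\<bar>approx ys x - f x\<bar> \<le> \<omega>"
      if ys: "length ys = N" "admissible_answers (Q * T ^ 4) f query ys" and x: "x \<in> unit_ball_n n" for ys x
    proof -
      have "approx ys \<in> F \<and> admissible_answers (Q * T ^ 4) (approx ys) query ys"
        unfolding approx_def
        by (rule someI[where P = "\<lambda>g. g \<in> F \<and> admissible_answers (Q * T ^ 4) g query ys" and x = f])
          (use f ys(2) in simp)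
      then show ?thesis
        unfolding F_def using f ys x assms(2)
        by (intro admissible_imp_close[where ys = ys]) (simp_all add: F_def)
    qed
    then have "{w \<in> space M. \<forall>ys. length ys = N \<and> admissible_answers (Q * T ^ 4) f query ys \<longrightarrow>
                 (\<forall>x \<in> unit_ball_n n. \<bar>approx ys x - f x\<bar> \<le> \<omega>)} = space M"
      by auto
    then show ?thesis
      using measure_pmf.prob_space[of "return_pmf (\<lambda>_. 0)"] assms(3) by (simp add: M_def)
  qed
  ultimately show ?thesis
    unfolding F_def by (intro exI[of _ M] exI[of _ "\<lambda>_. query"] exI[of _ "\<lambda>_. approx"]) auto
qed

theorem mainTheorem1:
  fixes \<sigma> :: real
  assumes "0 < \<sigma>" and "\<sigma> \<le> 1"
  shows "\<exists>C>0. \<forall>(n::nat) (Q::real) (\<delta>::real) (\<omega>::real).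
    2 \<le> n \<and> 1 \<le> Q \<and> 0 < \<delta> \<and> \<delta> < 1/2 \<and> 0 < \<omega> \<and> \<omega> < 1/2 \<longrightarrow>
    (\<exists>(M :: (nat \<Rightarrow> real) measure) query approx.
       prob_adaptive_algorithm n M query approx \<and>
       (\<forall>f \<in> ridge_class (real_trace ` analytic_class \<sigma> Q) n.
          \<P>(w in M. \<forall>ys. length ys = num_evals C n Q \<delta> \<omega> \<and>
                 admissible_answers (error_bound C n Q \<omega>) f (query w) ys \<longrightarrow>
                 (\<forall>x \<in> unit_ball_n n. \<bar>approx w ys x - f x\<bar> \<le> \<omega>))
            \<ge> 1 - \<delta>))"
proof -
  have \<rho>: "0 < \<sigma> / 2" "\<sigma> / 2 \<le> 1" "1 \<le> 2 / \<sigma>"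
    using assms by auto
  obtain c where c: "0 < c" and extrapolation: "\<And>(G :: complex \<Rightarrow> complex) K L r e t.
      G analytic_on rectangle (\<sigma> / 2) \<Longrightarrow> 1 \<le> L \<Longrightarrow> c * L \<le> real K \<Longrightarrow>
      (\<And>z. z \<in> rectangle (\<sigma> / 2) \<Longrightarrow> norm (G z) \<le> 2 / \<sigma> * exp L) \<Longrightarrow>
      r \<noteq> 0 \<Longrightarrow> \<bar>r\<bar> \<le> \<sigma> / 2 / 16 \<Longrightarrow>
      (\<And>j. j < K \<Longrightarrow> norm (G (of_real (r * real j / real K))) \<le> e) \<Longrightarrow>
      e * (36 / \<bar>r\<bar>) ^ K \<le> 1 \<Longrightarrow> \<bar>t\<bar> \<le> 1 \<Longrightarrow> norm (G (of_real t)) \<le> exp (- L) / 8"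
    apply (rule extrapolation[OF \<rho>])
    subgoal premises prems for c
      by (rule that; fact prems)
    done
  define A where "A = ln (1152 / \<sigma>)"
  define B where "B = ln (1000 / \<sigma> ^ 4)"
  have A: "0 \<le> A" and B: "0 \<le> B"
    unfolding A_def B_def using assms power_le_one[of \<sigma> 4] by (auto simp: le_divide_eq)
  \<comment> \<open>\<open>q\<close> is the exponent of \<open>Y\<close>: the amplification is
    \<open>exp (K * (A + ln n))\<close> with \<open>K \<le> (c + 1) * L\<close> and
    \<open>A \<le> 2 * A * ln n\<close>. In \<open>p\<close>, the summand \<open>q\<close> pays for
    \<open>Y\<close>, \<open>2 * B\<close> for \<open>1000 / \<sigma> ^ 4\<close>, 4 for
    \<open>exp (2 * L)\<close>, and \<open>c\<close> keeps the number of evaluations within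
    \<open>num_evals\<close>.\<close>
  define q where "q = (c + 1) * (2 * A + 1)"
  define p where "p = q + 2 * B + 4 + c"
  have q: "0 \<le> q"
    using A c by (simp add: q_def)
  have p: "0 < p"
    using q B c by (simp add: p_def)
  show ?thesis
  \<comment> \<open>The factor 4 is the exponent in the answer error
    \<open>Q * T ^ 4\<close>.\<close>
  proof (intro exI[of _ "4 * p"] conjI allI impI)
    show "0 < 4 * p"
      using p by simp
    fix n :: nat and Q \<delta> \<omega> :: real
    assume *: "2 \<le> n \<and> 1 \<le> Q \<and> 0 < \<delta> \<and> \<delta> < 1 / 2 \<and> 0 < \<omega> \<and> \<omega> < 1 / 2"
    define L where "L = ln (Q * real n / \<omega>)"
    define K where "K = nat \<lceil>c * L\<rceil>"
    define T where "T = exp (- (p * (L * ln n)))"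
    define Y where "Y = exp (q * (L * ln n))"
    have Qn: "2 \<le> Q * real n"
      using * mult_mono[of 1 Q 2 "real n"] by simp
    have "4 \<le> Q * real n / \<omega>"
      using Qn * by (simp add: le_divide_eq)
    then have exp_L: "exp L = Q * real n / \<omega>" and "ln 4 \<le> L"
      using * by (auto simp: L_def)
    moreover have "1 \<le> ln (4 :: real)"
      using exp_le by (subst ln_ge_iff) auto
    ultimately have L: "1 \<le> L"
      by linarith
    \<comment> \<open>From \<open>2 \<le> n\<close>; this lets constants and multiples of
      \<open>L\<close> be absorbed into multiples of \<open>L * ln n\<close>.\<close>
    have ln_n: "1 / 2 \<le> ln n"
    proof -
      have "1 / 2 \<le> ln (2 :: real)"
        using ln_2_less_1 ln2_ge_two_thirds by linarith
      also have "\<dots> \<le> ln n"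
        using * by simp
      finally show ?thesis .
    qed
    have Lln: "L \<le> 2 * (L * ln n)" "1 \<le> 2 * (L * ln n)" "0 \<le> L * ln n"
      using mult_left_mono[OF ln_n, of L] L by linarith+
    have K_ge: "c * L \<le> real K"
      unfolding K_def by linarith
    have "real K \<le> c * L + 1"
      unfolding K_def using c L by (simp add: of_nat_nat)
    then have K_le: "real K \<le> (c + 1) * L"
      using L by (simp add: algebra_simps)
    have K0: "0 < K"
      using K_ge c L by (metis less_le_trans mult_pos_pos of_nat_0_less_iff zero_less_one)
    have "recovery \<sigma> Q \<omega> T Y n K"
    proof
      show "(1152 * real n / \<sigma>) ^ K \<le> Y"
      proof -
        have "1152 * real n / \<sigma> = exp (A + ln n)"
          using * assms by (simp add: A_def exp_add)
        then have "(1152 * real n / \<sigma>) ^ K = exp (real K * (A + ln n))"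
          by (simp add: exp_of_nat_mult)
        also have "\<dots> \<le> exp ((c + 1) * L * ((2 * A + 1) * ln n))"
        proof -
          have "A + ln n \<le> (2 * A + 1) * ln n"
            using mult_left_mono[OF ln_n, of "2 * A"] A by (simp add: algebra_simps)
          then have "real K * (A + ln n) \<le> (c + 1) * L * ((2 * A + 1) * ln n)"
            using K_le A ln_n c L by (intro mult_mono) auto
          then show ?thesis by simp
        qed
        also have "\<dots> = Y"
          by (simp add: Y_def q_def mult_ac)
        finally show ?thesis .
      qed
      show "1 \<le> Y"
        using q Lln by (simp add: Y_def)
      show "T * (1000 * Q\<^sup>2 * (real n)\<^sup>2 / (\<sigma> ^ 4 * \<omega>) * Y) \<le> 1"
      proof -
        \<comment> \<open>A second factor \<open>1 / \<omega>\<close> is conceded to complete the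
          square of \<open>exp L\<close>.\<close>
        have "Q\<^sup>2 * (real n)\<^sup>2 / \<omega> \<le> Q\<^sup>2 * (real n)\<^sup>2 / \<omega>\<^sup>2"
          using * by (intro divide_left_mono) (auto simp: power2_eq_square)
        also have "\<dots> = (exp L)\<^sup>2"
          by (simp add: exp_L power_divide power_mult_distrib)
        also have "\<dots> = exp (2 * L)"
          by (simp add: exp_double)
        finally have "1000 / \<sigma> ^ 4 * (Q\<^sup>2 * (real n)\<^sup>2 / \<omega>) \<le> exp B * exp (2 * L)"
          using assms * by (intro mult_mono) (auto simp: B_def)
        then have "T * (1000 / \<sigma> ^ 4 * (Q\<^sup>2 * (real n)\<^sup>2 / \<omega>) * Y) \<le> T * (exp B * exp (2 * L) * Y)"
          by (intro mult_left_mono mult_right_mono) (auto simp: T_def Y_def)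
        also have "\<dots> = exp (B + 2 * L + q * (L * ln n) - p * (L * ln n))"
          by (simp add: T_def Y_def exp_add exp_diff exp_minus field_simps)
        also have "\<dots> \<le> 1"
        proof -
          have "B \<le> 2 * B * (L * ln n)"
            using mult_left_mono[OF Lln(2) B] by simp
          moreover have "0 \<le> c * (L * ln n)"
            using c Lln by simp
          moreover have "p * (L * ln n) = q * (L * ln n) + 2 * B * (L * ln n) + 4 * (L * ln n) + c * (L * ln n)"
            by (simp add: p_def algebra_simps)
          ultimately show ?thesis
            using Lln(1) by simp
        qed
        finally show ?thesis
          by simp
      qed
      show "norm (G (of_real t)) \<le> \<omega> / 8"
        if "G analytic_on rectangle (\<sigma> / 2)"
          and B: "\<And>z. z \<in> rectangle (\<sigma> / 2) \<Longrightarrow> norm (G z) \<le> 2 * Q / \<sigma>"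
          and "r \<noteq> 0" and "\<bar>r\<bar> \<le> \<sigma> / 32"
          and "\<And>j. j < K \<Longrightarrow> norm (G (of_real (r * real j / real K))) \<le> e"
          and "e * (36 / \<bar>r\<bar>) ^ K \<le> 1" and "\<bar>t\<bar> \<le> 1" for G :: "complex \<Rightarrow> complex" and r e t
      proof -
        \<comment> \<open>\<open>Q \<le> exp L\<close>, so the bound 2 Q / \<sigma> fits the growth
          \<open>b * exp L\<close> with \<open>b = 2 / \<sigma>\<close>, the value for which
          \<open>c\<close> was obtained.\<close>
        have "Q * 1 \<le> Q * (real n / \<omega>)"
          using * by (intro mult_left_mono) (auto simp: le_divide_eq)
        then have "2 / \<sigma> * Q \<le> 2 / \<sigma> * exp L"
          using assms by (intro mult_left_mono) (auto simp: exp_L)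
        then have "2 * Q / \<sigma> \<le> 2 / \<sigma> * exp L"
          by simp
        then have "norm (G (of_real t)) \<le> exp (- L) / 8"
          using that by (intro extrapolation[of G L K r e t] L K_ge) (auto intro: order_trans)
        also have "exp (- L) \<le> \<omega>"
          using * Qn by (simp add: exp_minus exp_L divide_le_eq)
        finally show ?thesis
          by simp
      qed
    qed (use * assms K0 in \<open>auto simp: T_def\<close>)
    moreover have "2 * (n * K) + n \<le> num_evals (4 * p) n Q \<delta> \<omega>"
    proof -
      \<comment> \<open>There are \<open>2 * K + 1\<close> evaluations per dimension, linear in
        \<open>L\<close>; \<open>L \<le> L\<^sup>2\<close> and \<open>p \<ge> 4 + c\<close> fit them
        into the budget.\<close>
      have "2 * real K + 1 \<le> (2 * c + 3) * L"
        using K_le L by (simp add: algebra_simps)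
      also have "\<dots> \<le> 4 * p * L\<^sup>2"
        using L c q B by (simp add: power2_eq_square p_def mult_mono)
      finally have "(2 * real K + 1) * n \<le> 4 * p * L\<^sup>2 * n"
        by (intro mult_right_mono) auto
      also have "\<dots> \<le> 4 * p * L\<^sup>2 * (ln (1 / \<delta>) + n)"
        using p * by (intro mult_left_mono) auto
      finally have "real (2 * (n * K) + n) \<le> 4 * p * L\<^sup>2 * (ln (1 / \<delta>) + n)"
        by (simp add: algebra_simps)
      then show ?thesis
        unfolding num_evals_def L_def by linarith
    qed
    moreover have "error_bound (4 * p) n Q \<omega> = Q * T ^ 4"
      by (simp add: error_bound_def T_def L_def mult_ac flip: exp_of_nat_mult)
    ultimately show "\<exists>(M :: (nat \<Rightarrow> real) measure) query approx.
       prob_adaptive_algorithm n M query approx \<and>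
       (\<forall>f \<in> ridge_class (real_trace ` analytic_class \<sigma> Q) n.
          \<P>(w in M. \<forall>ys. length ys = num_evals (4 * p) n Q \<delta> \<omega> \<and>
                 admissible_answers (error_bound (4 * p) n Q \<omega>) f (query w) ys \<longrightarrow>
                 (\<forall>x \<in> unit_ball_n n. \<bar>approx w ys x - f x\<bar> \<le> \<omega>))
            \<ge> 1 - \<delta>)"
      using exists_recovery_algorithm[of \<sigma> Q \<omega> T Y n K _ \<delta>] * by simp
  qed
qed

end
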